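(* Let $a\in\mathbb{R}\setminus\{0\}$. For each $N\ge1$ let $M=M_N=VDV^*$, where $V$ is an $N\times N$ Haar-distributed unitary matrix and $D=\mathrm{diag}(Z_1,\dots,Z_N)$ is independent of $V$, with $Z_1,\dots,Z_N$ i.i.d. random variables on the unit circle (whose common law may depend on $N$). Assume that almost surely $D$ has simple spectrum, and that for every integer $b$, $\sup_{k\ge 1}|\mathbb{E}[Z_1^k]|=o(N^{-b})$ as $N\to\infty$. Let $v=v_N\in\mathbb{C}^N$ be a unit vector which is either deterministic, or random, independent of $M$ and distributed with a non-vanishing density on the unit sphere of $\mathbb{C}^N$. For $t\in[-1,1]$ let $A(t)=I_N-(1-t)vv^*$ and $G(t)=G_N(t)=MA(t)$. Then $G(t)$ has no strongly separated outlier towards the origin at time $t=aN^{-1/2}$.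
   Context: $\mathbb{D}$ is the open unit disk and $D(0,r)$ the open disk of center $0$ and radius $r$. The density of a random $v$ is with respect to the uniform measure on the unit sphere. A sequence of events $\Omega^{(N)}$ occurs with high probability if $\mathbb{P}(\Omega^{(N)})\to1$ as $N\to\infty$. A sequence of $N\times N$ random matrices $G_N(t)$ has a strongly separated outlier towards the origin for $t\in T\subset[-1,1]$ (where $T$ may depend on $N$) if there exist real numbers $\alpha_1<\alpha_2$ and $d_1,d_2\in(0,1)$ such that, with high probability, for every $t\in T$: (1) $D\big(0,d_1\frac{N^{\alpha_1}}{1+N^{\alpha_1}}\big)$ contains exactly one eigenvalue of $G_N(t)$; and (2) $\mathbb{D}\setminus D\big(0,d_2\frac{N^{\alpha_2}}{1+N^{\alpha_2}}\big)$ contains $N-1$ eigenvalues of $G_N(t)$. Eigenvalues are counted with multiplicity. "At time $t=aN^{-1/2}$" means $T=\{aN^{-1/2}\}$, considered for $N\ge a^2$, so that $aN^{-1/2}\in[-1,1]$. *)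

theory Defs
  imports
    "HOL-Probability.Probability"
    "HOL-Library.Landau_Symbols"
    "Jordan_Normal_Form.Spectral_Radius"
begin

unbundle no vec_syntax
unbundle no inner_syntax

(* Borel structures on the spaces of complex N-vectors and N x N matrices: the coarsest
   ones for which the tuple of all entries is measurable. *)

definition borel_vec :: "nat \<Rightarrow> complex Matrix.vec measure" where
  "borel_vec N = vimage_algebra (carrier_vec N) (\<lambda>v. \<lambda>i\<in>{..<N}. v $ i)
     (PiM {..<N} (\<lambda>_. borel))"

definition borel_mat :: "nat \<Rightarrow> complex Matrix.mat measure" where
  "borel_mat N = vimage_algebra (carrier_mat N N) (\<lambda>A. \<lambda>ij\<in>{..<N} \<times> {..<N}. A $$ ij)
     (PiM ({..<N} \<times> {..<N}) (\<lambda>_. borel))"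

definition unitary_group :: "nat \<Rightarrow> complex Matrix.mat set" where
  "unitary_group N = {U \<in> carrier_mat N N. U * mat_adjoint U = 1\<^sub>m N}"

definition borel_unitary :: "nat \<Rightarrow> complex Matrix.mat measure" where
  "borel_unitary N = restrict_space (borel_mat N) (unitary_group N)"

(* The invariant probability measure on a compact group is unique, and left invariance
   implies right invariance. *)
definition haar_unitary :: "nat \<Rightarrow> complex Matrix.mat measure \<Rightarrow> bool" where
  "haar_unitary N \<mu> \<longleftrightarrow> prob_space \<mu> \<and> sets \<mu> = sets (borel_unitary N) \<and>
     (\<forall>U\<in>unitary_group N. distr \<mu> (borel_unitary N) (\<lambda>W. U * W) = \<mu>)"

definition unit_vectors :: "nat \<Rightarrow> complex Matrix.vec set" where
  "unit_vectors N = {v \<in> carrier_vec N. v \<bullet>c v = 1}"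

(* Normalised surface measure of the unit sphere of C^N, obtained as the law of x / |x| for
   x uniform in the unit ball.  It is carried by the whole vector space only because the
   null vector, which has probability 0 when N > 0, has no normalisation. *)
definition uniform_sphere :: "nat \<Rightarrow> complex Matrix.vec measure" where
  "uniform_sphere N =
     distr
       (uniform_measure (PiM {..<N} (\<lambda>_. lborel))
          {x \<in> space (PiM {..<N} (\<lambda>_. lborel)). (\<Sum>i<N. (cmod (x i))\<^sup>2) \<le> 1})
       (borel_vec N)
       (\<lambda>x. Matrix.vec N (\<lambda>i. x i / of_real (sqrt (\<Sum>j<N. (cmod (x j))\<^sup>2))))"

(* v v^* *)
definition proj_mat :: "complex Matrix.vec \<Rightarrow> complex Matrix.mat" where
  "proj_mat v = Matrix.mat (dim_vec v) (dim_vec v) (\<lambda>(i, j). v $ i * cnj (v $ j))"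

(* indep_var of the library needs random variables with values in the same type *)
definition indep_rv ::
  "'w measure \<Rightarrow> 'b measure \<Rightarrow> ('w \<Rightarrow> 'b) \<Rightarrow> 'c measure \<Rightarrow> ('w \<Rightarrow> 'c) \<Rightarrow> bool" where
  "indep_rv P S X T Y \<longleftrightarrow> X \<in> measurable P S \<and> Y \<in> measurable P T \<and>
     prob_space.indep_set P
       {X -` B \<inter> space P | B. B \<in> sets S} {Y -` B \<inter> space P | B. B \<in> sets T}"

definition simple_spectrum :: "complex Matrix.mat \<Rightarrow> bool" where
  "simple_spectrum A \<longleftrightarrow> (\<forall>z\<in>spectrum A. order z (char_poly A) = 1)"

(* number of eigenvalues in S, counted with algebraic multiplicity *)
definition eig_count :: "complex Matrix.mat \<Rightarrow> complex set \<Rightarrow> nat" where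
  "eig_count A S = (\<Sum>z\<in>spectrum A \<inter> S. order z (char_poly A))"

(* For measurable events this says that the probabilities tend to 1; the inner
   approximation E only serves to give the notion its meaning for non-measurable ones. *)
definition with_high_probability :: "(nat \<Rightarrow> 'w measure) \<Rightarrow> (nat \<Rightarrow> 'w set) \<Rightarrow> bool" where
  "with_high_probability P \<Omega> \<longleftrightarrow>
     (\<exists>E. (\<forall>N. E N \<in> sets (P N) \<and> E N \<subseteq> \<Omega> N) \<and> (\<lambda>N. measure (P N) (E N)) \<longlonglongrightarrow> 1)"

(* G N t is an N x N random matrix on the probability space P N.  Only the sets T N with
   N large matter. *)
definition strongly_separated_outlier ::
  "(nat \<Rightarrow> 'w measure) \<Rightarrow> (nat \<Rightarrow> real \<Rightarrow> 'w \<Rightarrow> complex Matrix.mat) \<Rightarrow> (nat \<Rightarrow> real set) \<Rightarrow> bool" where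
  "strongly_separated_outlier P G T \<longleftrightarrow>
     (\<exists>\<alpha>\<^sub>1 \<alpha>\<^sub>2 d\<^sub>1 d\<^sub>2 :: real. \<alpha>\<^sub>1 < \<alpha>\<^sub>2 \<and> d\<^sub>1 \<in> {0<..<1} \<and> d\<^sub>2 \<in> {0<..<1} \<and>
        with_high_probability P
          (\<lambda>N. {\<omega> \<in> space (P N). \<forall>t\<in>T N.
             eig_count (G N t \<omega>)
               (ball 0 (d\<^sub>1 * (real N powr \<alpha>\<^sub>1 / (1 + real N powr \<alpha>\<^sub>1)))) = 1 \<and>
             eig_count (G N t \<omega>)
               (ball 0 1 - ball 0 (d\<^sub>2 * (real N powr \<alpha>\<^sub>2 / (1 + real N powr \<alpha>\<^sub>2)))) = N - 1}))"

end

theory Submission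
  imports Defs "HOL-Complex_Analysis.Residue_Theorem"
begin

text \<open>
  Write \<open>W = V\<^sup>* v\<close>, \<open>p\<^sub>i = |W\<^sub>i|\<^sup>2\<close> and \<open>m\<^sub>k = \<langle>M\<^sup>k v, v\<rangle> = \<Sum>\<^sub>i p\<^sub>i Z\<^sub>i\<^sup>k\<close>. Since \<open>G(t)\<close> is a rank one
  perturbation, the matrix determinant lemma gives, for \<open>|z| < 1\<close>,
  \<open>det (z - G(t)) = \<Prod>\<^sub>i (z - Z\<^sub>i) \<cdot> (t - (1 - t) \<Sum>\<^bsub>k\<ge>1\<^esub> cnj m\<^sub>k z\<^sup>k)\<close>. At time \<open>t = a / sqrt N\<close> the constant
  term and the coefficients \<open>m\<^sub>k\<close> are of the same order \<open>1 / sqrt N\<close>: the eigenvalues inside the disk are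
  those of a random power series with a nonzero constant term, which has no reason to have
  exactly one zero near the origin. It suffices to contradict the first requirement, namely that the
  disk \<open>D(0, r\<^sub>N)\<close> with \<open>r\<^sub>N = d\<^sub>1 N\<^sup>\<alpha> / (1 + N\<^sup>\<alpha>)\<close> contains exactly one eigenvalue with probability
  tending to 1.

  If \<open>\<alpha> < 0\<close> then \<open>r\<^sub>N \<rightarrow> 0\<close>, and second moments show that with probability at least 1/4 the
  series stays below its constant term on \<open>D(0, r\<^sub>N)\<close>, which then contains no eigenvalue
  (\<open>eig_count_eq_0\<close>).

  If \<open>\<alpha> \<ge> 0\<close> then \<open>r\<^sub>N \<ge> d\<^sub>1/2\<close>, and there is an event of probability bounded away from 0 on which the
  coefficient of \<open>z\<^sup>2\<close> dominates all the others on \<open>|z| = d\<^sub>1/2\<close>; by Rouche's theorem there are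
  then two eigenvalues in the disk (\<open>eig_count_eq_2\<close>). The event is found by a change of
  measure. Change the probability by the likelihood ratio \<open>L = \<Prod>\<^sub>i (1 + (s / sqrt N) (Re Z\<^sub>i\<^sup>2 - E Re Z\<^sub>i\<^sup>2))\<close>.
  Its second moment is at most \<open>exp (4 s\<^sup>2)\<close>, uniformly in \<open>N\<close>, so that events of tilted probability at
  least 1/2 keep a probability of at least \<open>exp (- 4 s\<^sup>2) / 4\<close>. The tilt shifts the mean of \<open>sqrt N m\<^sub>2\<close>
  by about \<open>s/2\<close> and leaves the means of the other \<open>sqrt N m\<^sub>k\<close> bounded, because the law of \<open>Z\<^sub>i\<close> is close
  to uniform; the tilted variances of all the \<open>sqrt N m\<^sub>k\<close> are bounded independently of \<open>s\<close> since
  \<open>E \<Sum>\<^sub>i p\<^sub>i\<^sup>2 = O(1/N)\<close>. Taking \<open>s\<close> large makes the quadratic term win, and \<open>s = 0\<close> covers the case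
  \<open>\<alpha> < 0\<close>. This is \<open>prob_small_total_deviation\<close>.

  The bound on \<open>E p\<^sub>i\<^sup>2\<close> comes from the left invariance of Haar measure: a unitary carries \<open>v\<close> to the
  vector with equal entries, and invariance under sign changes of the coordinates gives a
  Khinchine inequality with constant 3 (\<open>haar_overlap_fourth_moment_le\<close>). All estimates are uniform in
  the unit vector \<open>v\<close>, hence survive an integration over a random \<open>v\<close> independent of \<open>M\<close>.
\<close>

unbundle no vec_syntax
unbundle no inner_syntax

section \<open>Determinants and zeros of polynomials\<close>

lemma mat_adjoint_index [simp]:
  fixes A :: "complex Matrix.mat"
  shows "i < dim_col A \<Longrightarrow> j < dim_row A \<Longrightarrow> mat_adjoint A $$ (i, j) = cnj (A $$ (j, i))"
  unfolding mat_adjoint_def by (simp add: mat_of_rows_def cols_def)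

lemma mat_adjoint_dim [simp]:
  fixes A :: "complex Matrix.mat"
  shows "dim_row (mat_adjoint A) = dim_col A" "dim_col (mat_adjoint A) = dim_row A"
  unfolding mat_adjoint_def by simp_all

text \<open>
  The two ways of clearing a block of the bordered matrix with blocks \<open>\<Lambda>\<close>, \<open>- x\<close>, \<open>y\<^sup>T\<close>, \<open>1\<close>
  evaluate its determinant as either side of the identity.
\<close>
lemma det_diag_plus_rank_one:
  fixes l x y :: "nat \<Rightarrow> complex"
  assumes "\<And>i. i < n \<Longrightarrow> l i \<noteq> 0"
  shows "Determinant.det (Matrix.mat n n (\<lambda>(i, j). (if i = j then l i else 0) + x i * y j)) =
    (\<Prod>i<n. l i) * (1 + (\<Sum>i<n. x i * y i / l i))"
proof -
  define L where "L = mat_diag n l"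
  define X where "X = Matrix.mat n 1 (\<lambda>(i, j). - x i)"
  define Y where "Y = Matrix.mat 1 n (\<lambda>(i, j). y j)"
  define Y' where "Y' = Matrix.mat 1 n (\<lambda>(i, j). - y j / l j)"
  define B where "B = four_block_mat L X Y (1\<^sub>m 1)"
  define R where "R = Matrix.mat n n (\<lambda>(i, j). (if i = j then l i else 0) + x i * y j)"
  define S where "S = Matrix.mat 1 1 (\<lambda>(i::nat, j::nat). 1 + (\<Sum>i<n. x i * y i / l i))"
  have c: "L \<in> carrier_mat n n" "X \<in> carrier_mat n 1" "Y \<in> carrier_mat 1 n"
     "Y' \<in> carrier_mat 1 n" "- Y \<in> carrier_mat 1 n" "R \<in> carrier_mat n n" "S \<in> carrier_mat 1 1"
    unfolding L_def X_def Y_def Y'_def R_def S_def by auto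
  have detL: "Determinant.det L = (\<Prod>i<n. l i)"
  proof -
    have "upper_triangular L" unfolding L_def mat_diag_def by auto
    from det_upper_triangular[OF this c(1)] show ?thesis
      by (simp add: L_def mat_diag_def diag_mat_def atLeast0LessThan comp_def
           flip: prod.distinct_set_conv_list)
  qed
  have B: "B \<in> carrier_mat (n+1) (n+1)" unfolding B_def using c by auto
  have "B * four_block_mat (1\<^sub>m n) (0\<^sub>m n 1) (- Y) (1\<^sub>m 1) = four_block_mat R X (0\<^sub>m 1 n) (1\<^sub>m 1)"
    unfolding B_def using c
    by (subst mult_four_block_mat[of _ n n _ 1 _ 1 _ _ n _ 1], simp_all)
       (rule cong_four_block_mat; (rule eq_matI; auto simp: L_def X_def Y_def R_def scalar_prod_def mat_diag_def))
  then have 1: "Determinant.det B * Determinant.det (four_block_mat (1\<^sub>m n) (0\<^sub>m n 1) (- Y) (1\<^sub>m 1)) =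
       Determinant.det (four_block_mat R X (0\<^sub>m 1 n) (1\<^sub>m 1))"
    using det_mult[OF B four_block_carrier_mat[of "1\<^sub>m n" n n "1\<^sub>m 1" 1 1 "0\<^sub>m n 1" "- Y"]] by simp
  have detR: "Determinant.det B = Determinant.det R"
    using 1 c det_four_block_mat_upper_right_zero[of "1\<^sub>m n" n "0\<^sub>m n 1" 1 "- Y" "1\<^sub>m 1 :: complex Matrix.mat"]
      det_four_block_mat_lower_left_zero[of R n X 1 "0\<^sub>m 1 n" "1\<^sub>m 1"] by auto
  have "four_block_mat (1\<^sub>m n) (0\<^sub>m n 1) Y' (1\<^sub>m 1) * B = four_block_mat L X (0\<^sub>m 1 n) S"
    unfolding B_def using c assms
    by (subst mult_four_block_mat[of _ n n _ 1 _ 1 _ _ n _ 1], simp_all)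
       (rule cong_four_block_mat; (rule eq_matI;
        auto simp: L_def X_def Y_def Y'_def S_def scalar_prod_def mat_diag_def if_distrib[of "\<lambda>x. _ * x"]
          atLeast0LessThan mult.commute cong: if_cong))
  then have 2: "Determinant.det (four_block_mat (1\<^sub>m n) (0\<^sub>m n 1) Y' (1\<^sub>m 1)) * Determinant.det B =
       Determinant.det (four_block_mat L X (0\<^sub>m 1 n) S)"
    using det_mult[OF four_block_carrier_mat[of "1\<^sub>m n" n n "1\<^sub>m 1" 1 1 "0\<^sub>m n 1" Y'] B] by simp
  have "Determinant.det B = Determinant.det L * Determinant.det S"
    using 2 c det_four_block_mat_upper_right_zero[of "1\<^sub>m n" n "0\<^sub>m n 1" 1 Y' "1\<^sub>m 1 :: complex Matrix.mat"]
      det_four_block_mat_lower_left_zero[of L n X 1 "0\<^sub>m 1 n" S] by auto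
  moreover have "Determinant.det S = 1 + (\<Sum>i<n. x i * y i / l i)"
    using det_single[of S] c by (simp add: S_def)
  ultimately show ?thesis using detR detL unfolding R_def by simp
qed

text \<open>
  On the unit circle \<open>1/\<zeta> = cnj \<zeta>\<close>, so the Cauchy kernel expands in the conjugate moments.
\<close>
lemma geometric_cauchy_kernel:
  fixes \<zeta> z :: complex
  assumes "cmod \<zeta> = 1" "cmod z < 1"
  shows "(\<lambda>j. (cnj \<zeta> * z) ^ Suc j) sums (- \<zeta> / (z - \<zeta>) - 1)"
proof -
  have "\<zeta> * cnj \<zeta> = 1" using assms(1) by (metis complex_norm_square of_real_1 one_power2)
  moreover have "norm (cnj \<zeta> * z) < 1" using assms by (simp add: norm_mult)
  from geometric_sums[OF this] have "(\<lambda>j. (cnj \<zeta> * z) ^ Suc j) sums (1 / (1 - cnj \<zeta> * z) - 1)"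
    by (subst sums_Suc_iff) simp
  moreover have "\<zeta> \<noteq> 0" "z \<noteq> \<zeta>" using assms by auto
  moreover have "1 / (1 - cnj \<zeta> * z) = - \<zeta> / (z - \<zeta>)"
  proof -
    have "1 - cnj \<zeta> * z \<noteq> 0"
      using \<open>norm (cnj \<zeta> * z) < 1\<close> by auto
    then show ?thesis using calculation by (simp add: field_simps)
  qed
  ultimately show ?thesis by metis
qed

lemma zorder_poly_eq_order:
  fixes p :: "complex poly"
  assumes "p \<noteq> 0"
  shows "zorder (poly p) z = int (order z p)"
proof -
  obtain q where q: "p = [:- z, 1:] ^ order z p * q" "\<not> [:- z, 1:] dvd q"
    using order_decomp[OF assms] by blast
  have "poly q z \<noteq> 0" using q(2) by (simp add: poly_eq_0_iff_dvd)
  moreover have "poly p w = poly q w * (w - z) powi int (order z p)" for w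
    by (subst q(1)) (simp add: poly_power poly_mult)
  moreover have "poly q holomorphic_on UNIV" by (intro holomorphic_intros)
  ultimately show ?thesis by (intro zorder_eqI[where S = UNIV and g = "poly q"]) auto
qed

text \<open>
  The analytic form of Rouche's theorem weights zeros by winding numbers and analytic orders. For
  a circle the weights are 0 or 1, and for polynomials the orders are algebraic multiplicities, which
  is how eigenvalues are counted.
\<close>
lemma polynomial_Rouche:
  fixes p q :: "complex poly"
  assumes "\<rho> > 0" and less: "\<And>z. cmod z = \<rho> \<Longrightarrow> cmod (poly q z) < cmod (poly p z)"
  shows "(\<Sum>z\<in>{z\<in>ball 0 \<rho>. poly (p + q) z = 0}. order z (p + q)) =
    (\<Sum>z\<in>{z\<in>ball 0 \<rho>. poly p z = 0}. order z p)"
proof -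
  have on: "cmod (complex_of_real \<rho>) = \<rho>" using assms by simp
  have nz: "p \<noteq> 0" "p + q \<noteq> 0"
  proof -
    show "p \<noteq> 0" using less[OF on] by auto
    show "p + q \<noteq> 0" using less[OF on] by (metis add_eq_0_iff norm_minus_cancel order_less_irrefl poly_minus)
  qed
  have count: "(\<Sum>z\<in>{z\<in>UNIV. poly r z = 0}. winding_number (circlepath 0 \<rho>) z * zorder (poly r) z) =
      of_nat (\<Sum>z\<in>{z\<in>ball 0 \<rho>. poly r z = 0}. order z r)"
    if "r \<noteq> 0" and off: "\<And>z. cmod z = \<rho> \<Longrightarrow> poly r z \<noteq> 0" for r
  proof -
    have fin: "finite {z\<in>UNIV. poly r z = 0}" using poly_roots_finite[OF that(1)] by simp
    have "(\<Sum>z\<in>{z\<in>UNIV. poly r z = 0}. winding_number (circlepath 0 \<rho>) z * zorder (poly r) z) =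
       (\<Sum>z\<in>{z\<in>ball 0 \<rho>. poly r z = 0}. winding_number (circlepath 0 \<rho>) z * zorder (poly r) z)"
    proof (rule sum.mono_neutral_right[OF fin], force, rule ballI)
      fix z assume z: "z \<in> {z\<in>UNIV. poly r z = 0} - {z\<in>ball 0 \<rho>. poly r z = 0}"
      then have "cmod z \<noteq> \<rho>" using off by auto
      with z have "z \<notin> cball 0 \<rho>" by auto
      then have "winding_number (circlepath 0 \<rho>) z = 0"
        using assms(1) by (intro winding_number_zero_outside[where s = "cball 0 \<rho>"]) auto
      then show "winding_number (circlepath 0 \<rho>) z * complex_of_int (zorder (poly r) z) = 0" by simp
    qed
    also have "\<dots> = (\<Sum>z\<in>{z\<in>ball 0 \<rho>. poly r z = 0}. of_nat (order z r))"
      by (rule sum.cong) (auto simp: winding_number_circlepath zorder_poly_eq_order[OF that(1)])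
    finally show ?thesis by simp
  qed
  have off: "poly p z \<noteq> 0" "poly (p + q) z \<noteq> 0" if "cmod z = \<rho>" for z
    using less[OF that] by (auto simp: add_eq_0_iff2)
  have "(\<Sum>z\<in>{z\<in>UNIV. poly p z + poly q z = 0}. winding_number (circlepath 0 \<rho>) z * zorder (\<lambda>z. poly p z + poly q z) z) =
      (\<Sum>z\<in>{z\<in>UNIV. poly p z = 0}. winding_number (circlepath 0 \<rho>) z * zorder (poly p) z)"
  proof (rule Rouche_theorem)
    show "finite {z\<in>UNIV. poly p z + poly q z = 0}" using poly_roots_finite[OF nz(2)] by simp
    show "finite {z\<in>UNIV. poly p z = 0}" using poly_roots_finite[OF nz(1)] by simp
    show "\<forall>z\<in>path_image (circlepath 0 \<rho>). cmod (poly q z) < cmod (poly p z)"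
      using assms by auto
  qed (auto intro!: holomorphic_intros)
  then have "(\<Sum>z\<in>{z\<in>UNIV. poly (p + q) z = 0}. winding_number (circlepath 0 \<rho>) z * zorder (poly (p + q)) z) =
      (\<Sum>z\<in>{z\<in>UNIV. poly p z = 0}. winding_number (circlepath 0 \<rho>) z * zorder (poly p) z)"
    by (simp add: poly_add[abs_def])
  then have "complex_of_nat (\<Sum>z\<in>{z\<in>ball 0 \<rho>. poly (p + q) z = 0}. order z (p + q)) =
    of_nat (\<Sum>z\<in>{z\<in>ball 0 \<rho>. poly p z = 0}. order z p)"
    using count[OF nz(1) off(1)] count[OF nz(2) off(2)] by simp
  then show ?thesis by (simp only: of_nat_eq_iff)
qed

section \<open>Eigenvalues of the perturbed matrix near the origin\<close>

definition moment :: "complex Matrix.mat \<Rightarrow> complex Matrix.vec \<Rightarrow> nat \<Rightarrow> complex" where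
  "moment A u k = ((A ^\<^sub>m k) *\<^sub>v u) \<bullet>c u"

definition overlap :: "complex Matrix.mat \<Rightarrow> complex Matrix.vec \<Rightarrow> nat \<Rightarrow> complex" where
  "overlap V u i = (mat_adjoint V *\<^sub>v u) $ i"

text \<open>
  The rescaled moment measured against its mean under the tilted probability, which is
  concentrated on \<open>k = 2\<close>.
\<close>
definition deviation :: "nat \<Rightarrow> real \<Rightarrow> complex Matrix.mat \<Rightarrow> complex Matrix.vec \<Rightarrow> nat \<Rightarrow> complex" where
  "deviation N s A u k = of_real (sqrt (real N)) * moment A u k - (if k = 2 then of_real (s / 2) else 0)"

text \<open>
  Weighted so as to control a power series on the disk of radius \<open>\<rho>\<close>. The sum starts at the first
  moment, since the moment of order 0 of a unit vector is always 1.
\<close>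
definition total_deviation ::
  "nat \<Rightarrow> real \<Rightarrow> real \<Rightarrow> complex Matrix.mat \<Rightarrow> complex Matrix.vec \<Rightarrow> real" where
  "total_deviation N \<rho> s A u = (\<Sum>j. \<rho> ^ Suc j * cmod (deviation N s A u (Suc j)))"

lemma unitary_groupD:
  assumes "U \<in> unitary_group N"
  shows "U \<in> carrier_mat N N" "mat_adjoint U \<in> carrier_mat N N"
    "U * mat_adjoint U = 1\<^sub>m N" "mat_adjoint U * U = 1\<^sub>m N"
proof -
  show c: "U \<in> carrier_mat N N" "U * mat_adjoint U = 1\<^sub>m N"
    using assms by (auto simp: unitary_group_def)
  show c': "mat_adjoint U \<in> carrier_mat N N" using c(1) by (auto intro!: carrier_matI)
  show "mat_adjoint U * U = 1\<^sub>m N" by (rule mat_mult_left_right_inverse[OF c(1) c' c(2)])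
qed

lemma mat_adjoint_adjoint [simp]: "mat_adjoint (mat_adjoint A) = (A :: complex Matrix.mat)"
  by (rule eq_matI) auto

lemma adjoint_cscalar_prod:
  fixes A :: "complex Matrix.mat"
  assumes "A \<in> carrier_mat n m" "x \<in> carrier_vec m" "y \<in> carrier_vec n"
  shows "(A *\<^sub>v x) \<bullet>c y = x \<bullet>c (mat_adjoint A *\<^sub>v y)"
proof -
  have "(A *\<^sub>v x) \<bullet>c y = (\<Sum>i<n. \<Sum>j<m. A $$ (i, j) * x $ j * cnj (y $ i))"
    using assms by (simp add: scalar_prod_def atLeast0LessThan sum_distrib_right)
  also have "\<dots> = (\<Sum>j<m. \<Sum>i<n. A $$ (i, j) * x $ j * cnj (y $ i))" by (rule sum.swap)
  also have "\<dots> = x \<bullet>c (mat_adjoint A *\<^sub>v y)"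
    using assms by (simp add: scalar_prod_def atLeast0LessThan sum_distrib_left mult.assoc mult.left_commute)
  finally show ?thesis .
qed

lemma cscalar_self: "x \<bullet>c x = of_real (\<Sum>i<dim_vec x. (cmod (x $ i))\<^sup>2)"
  by (simp add: scalar_prod_def atLeast0LessThan complex_norm_square del: of_real_power)

lemma mat_diag_power: "mat_diag n f ^\<^sub>m k = mat_diag n (\<lambda>i. f i ^ k :: complex)"
proof (induction k)
  case 0
  have "dim_row (mat_diag n f) = n" by (simp add: mat_diag_def)
  then show ?case by simp
next
  case (Suc k)
  then show ?case by (simp add: mult.commute)
qed

lemma mat_diag_mult_vec:
  "x \<in> carrier_vec n \<Longrightarrow> mat_diag n f *\<^sub>v x = Matrix.vec n (\<lambda>i. f i * x $ i :: complex)"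
  by (rule eq_vecI) (auto simp: scalar_prod_def mat_diag_def if_distrib[of "\<lambda>x. x * _"] cong: if_cong)

lemma moment_conj_diag:
  assumes V: "V \<in> unitary_group N" and u: "u \<in> carrier_vec N"
  shows "moment (V * mat_diag N z * mat_adjoint V) u k =
    (\<Sum>i<N. of_real ((cmod (overlap V u i))\<^sup>2) * z i ^ k)"
proof -
  note V' = unitary_groupD[OF V]
  let ?D = "mat_diag N (\<lambda>i. z i ^ k)"
  define w where "w = mat_adjoint V *\<^sub>v u"
  have w: "w \<in> carrier_vec N" unfolding w_def by (rule mult_mat_vec_carrier[OF V'(2) u])
  have "similar_mat_wit (V * mat_diag N z * mat_adjoint V) (mat_diag N z) V (mat_adjoint V)"
    by (rule similar_mat_witI[OF V'(3,4) refl mult_carrier_mat[OF mult_carrier_mat[OF V'(1) mat_diag_dim] V'(2)] mat_diag_dim V'(1,2)])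
  from similar_mat_wit_pow_id[OF this, of k]
  have "moment (V * mat_diag N z * mat_adjoint V) u k = (V * ?D * mat_adjoint V *\<^sub>v u) \<bullet>c u"
    unfolding moment_def by (simp add: mat_diag_power)
  also have "V * ?D * mat_adjoint V *\<^sub>v u = V *\<^sub>v (?D *\<^sub>v w)"
  proof -
    have D: "?D \<in> carrier_mat N N" by simp
    have VD: "V * ?D \<in> carrier_mat N N" using V'(1) D by (rule mult_carrier_mat)
    show ?thesis unfolding w_def
      using assoc_mult_mat_vec[OF VD V'(2) u] assoc_mult_mat_vec[OF V'(1) D w] by (simp add: w_def)
  qed
  also have "(V *\<^sub>v (?D *\<^sub>v w)) \<bullet>c u = (?D *\<^sub>v w) \<bullet>c w"
    unfolding w_def
    by (rule adjoint_cscalar_prod[OF V'(1) mult_mat_vec_carrier[OF mat_diag_dim mult_mat_vec_carrier[OF V'(2) u]] u])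
  also have "\<dots> = (\<Sum>i<N. of_real ((cmod (w $ i))\<^sup>2) * z i ^ k)"
    using w by (simp add: mat_diag_mult_vec[OF w] scalar_prod_def atLeast0LessThan complex_norm_square mult_ac del: of_real_power)
  finally show ?thesis by (simp add: overlap_def w_def)
qed

lemma overlap_sum_squares:
  assumes V: "V \<in> unitary_group N" and u: "u \<in> unit_vectors N"
  shows "(\<Sum>i<N. (cmod (overlap V u i))\<^sup>2) = 1"
proof -
  note V' = unitary_groupD[OF V]
  have u': "u \<in> carrier_vec N" "u \<bullet>c u = 1" using u by (auto simp: unit_vectors_def)
  let ?w = "mat_adjoint V *\<^sub>v u"
  have w: "?w \<in> carrier_vec N" by (rule mult_mat_vec_carrier[OF V'(2) u'(1)])
  have "?w \<bullet>c ?w = u \<bullet>c (V *\<^sub>v ?w)"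
    using adjoint_cscalar_prod[OF V'(2) u'(1) w] by simp
  also have "V *\<^sub>v ?w = u"
    using assoc_mult_mat_vec[OF V'(1,2) u'(1)] V'(3) one_mult_mat_vec[OF u'(1)] by simp
  finally have "of_real (\<Sum>i<N. (cmod (?w $ i))\<^sup>2) = (1::complex)"
    using u' V'(1) by (simp add: cscalar_self)
  then show ?thesis by (simp only: of_real_eq_1_iff overlap_def)
qed

lemma mat_mult_assoc5:
  assumes "A \<in> carrier_mat n n" "B \<in> carrier_mat n n" "C \<in> carrier_mat n n"
    "D \<in> carrier_mat n n" "E \<in> carrier_mat n n"
  shows "A * (B * (C * D * E)) = A * B * C * D * (E :: complex Matrix.mat)"
proof -
  have CD: "C * D \<in> carrier_mat n n" and AB: "A * B \<in> carrier_mat n n"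
    and BCD: "B * (C * D) \<in> carrier_mat n n" using assms by auto
  have "A * B * C * D * E = A * (B * (C * D)) * E"
    using assoc_mult_mat[OF AB assms(3,4)] assoc_mult_mat[OF assms(1,2) CD] by simp
  also have "\<dots> = A * (B * (C * D * E))"
    using assoc_mult_mat[OF assms(1) BCD assms(5)] assoc_mult_mat[OF assms(2) CD assms(5)] by simp
  finally show ?thesis by simp
qed

text \<open>
  Conjugation by \<open>V\<close> replaces \<open>V D V\<^sup>*\<close> by the diagonal matrix \<open>D\<close> and \<open>u\<close> by \<open>V\<^sup>* u\<close>; then the
  matrix determinant lemma applies.
\<close>
lemma char_poly_conj_rank_one:
  assumes V: "V \<in> unitary_group N" and u: "u \<in> carrier_vec N" and \<zeta>: "\<And>i. i < N \<Longrightarrow> \<zeta> \<noteq> z i"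
  shows "poly (char_poly (V * mat_diag N z * mat_adjoint V * (1\<^sub>m N - c \<cdot>\<^sub>m proj_mat u))) \<zeta> =
    (\<Prod>i<N. \<zeta> - z i) * (1 + c * (\<Sum>i<N. of_real ((cmod (overlap V u i))\<^sup>2) * z i / (\<zeta> - z i)))"
proof -
  note V' = unitary_groupD[OF V]
  define w where "w = mat_adjoint V *\<^sub>v u"
  have w: "w \<in> carrier_vec N" unfolding w_def by (rule mult_mat_vec_carrier[OF V'(2) u])
  let ?W = "mat_adjoint V"
  let ?D = "mat_diag N z"
  let ?I = "1\<^sub>m N :: complex Matrix.mat"
  let ?G = "V * ?D * ?W * (?I - c \<cdot>\<^sub>m proj_mat u)"
  let ?B = "?D * (?I - c \<cdot>\<^sub>m proj_mat w)"
  have pu: "proj_mat u \<in> carrier_mat N N" and pw: "proj_mat w \<in> carrier_mat N N"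
    using u w by (auto simp: proj_mat_def)
  have pw_eq: "?W * proj_mat u * V = proj_mat w"
  proof (rule eq_matI)
    fix i j assume ij: "i < dim_row (proj_mat w)" "j < dim_col (proj_mat w)"
    then have ij: "i < N" "j < N" using pw by auto
    have "(?W * proj_mat u * V) $$ (i, j) = (\<Sum>l<N. (\<Sum>k<N. cnj (V $$ (k, i)) * (u $ k * cnj (u $ l))) * V $$ (l, j))"
      using ij V' u by (simp add: proj_mat_def scalar_prod_def atLeast0LessThan)
    also have "\<dots> = (\<Sum>k<N. cnj (V $$ (k, i)) * u $ k) * cnj (\<Sum>l<N. cnj (V $$ (l, j)) * u $ l)"
      by (simp add: sum_distrib_left sum_distrib_right mult_ac)
    also have "\<dots> = proj_mat w $$ (i, j)"
      using ij V' u by (simp add: proj_mat_def w_def scalar_prod_def atLeast0LessThan)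
    finally show "(?W * proj_mat u * V) $$ (i, j) = proj_mat w $$ (i, j)" .
  qed (use pw V' in auto)
  have "?W * (?I - c \<cdot>\<^sub>m proj_mat u) * V = ?I - c \<cdot>\<^sub>m proj_mat w"
  proof -
    have "?W * (?I - c \<cdot>\<^sub>m proj_mat u) = ?W - c \<cdot>\<^sub>m (?W * proj_mat u)"
      using V' pu by (simp add: mult_minus_distrib_mat[of _ N N _ N] mult_smult_distrib[of _ N N _ N])
    also have "\<dots> * V = ?I - c \<cdot>\<^sub>m (?W * proj_mat u * V)"
      using V' pu by (simp add: minus_mult_distrib_mat[of _ N N _ _ N] mult_smult_assoc_mat[of _ N N _ N])
    finally show ?thesis by (simp only: pw_eq)
  qed
  then have key: "?B = ?D * (?W * (?I - c \<cdot>\<^sub>m proj_mat u) * V)" by simp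
  have cI: "?I - c \<cdot>\<^sub>m proj_mat u \<in> carrier_mat N N" using pu by auto
  have G_carrier: "?G \<in> carrier_mat N N" using V'(1,2) cI by (auto intro!: mult_carrier_mat[of _ N N])
  have "V * ?B = ?G * V"
    unfolding key by (rule mat_mult_assoc5[of _ N]) (use V'(1,2) cI in auto)
  then have "V * ?B * ?W = ?G * (V * ?W)"
    using assoc_mult_mat[OF G_carrier V'(1,2)] by simp
  then have G: "?G = V * ?B * ?W" using V'(3) right_mult_one_mat[OF G_carrier] by simp
  have B: "?B \<in> carrier_mat N N" using pw by (auto intro!: mult_carrier_mat[of _ N N])
  have "similar_mat ?G ?B"
    by (rule similar_matI[OF _ V'(3,4) G]) (use V'(1,2) G_carrier B in auto)
  then have "poly (char_poly ?G) \<zeta> = Determinant.det (- char_matrix ?B \<zeta>)"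
    using char_poly_matrix[OF B] char_poly_similar by metis
  also have "- char_matrix ?B \<zeta> =
      Matrix.mat N N (\<lambda>(i, j). (if i = j then \<zeta> - z i else 0) + (c * z i * w $ i) * cnj (w $ j))"
  proof (rule eq_matI)
    have entry: "?B $$ (i, j) = z i * ((if i = j then 1 else 0) - c * (w $ i * cnj (w $ j)))"
      if "i < N" "j < N" for i j
      using that pw w by (subst mat_diag_mult_left[of _ N N]) (auto simp: proj_mat_def)
    define Bm where "Bm = ?B"
    have Bm: "Bm \<in> carrier_mat N N" using B by (simp add: Bm_def)
    fix i j
    assume "i < dim_row (Matrix.mat N N (\<lambda>(i, j). (if i = j then \<zeta> - z i else 0) + (c * z i * w $ i) * cnj (w $ j)))"
      "j < dim_col (Matrix.mat N N (\<lambda>(i, j). (if i = j then \<zeta> - z i else 0) + (c * z i * w $ i) * cnj (w $ j)))"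
    then show "(- char_matrix ?B \<zeta>) $$ (i, j) =
      Matrix.mat N N (\<lambda>(i, j). (if i = j then \<zeta> - z i else 0) + (c * z i * w $ i) * cnj (w $ j)) $$ (i, j)"
      using Bm entry[folded Bm_def, of i j] unfolding Bm_def[symmetric]
      by (auto simp: char_matrix_def algebra_simps)
  qed (use B in \<open>auto simp: char_matrix_def\<close>)
  also have "Determinant.det \<dots> =
      (\<Prod>i<N. \<zeta> - z i) * (1 + (\<Sum>i<N. (c * z i * w $ i) * cnj (w $ i) / (\<zeta> - z i)))"
    by (rule det_diag_plus_rank_one) (use \<zeta> in auto)
  also have "(\<Sum>i<N. (c * z i * w $ i) * cnj (w $ i) / (\<zeta> - z i)) =
      c * (\<Sum>i<N. of_real ((cmod (w $ i))\<^sup>2) * z i / (\<zeta> - z i))"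
    unfolding sum_distrib_left complex_norm_square by (rule sum.cong) (auto simp: mult_ac)
  finally show ?thesis unfolding overlap_def w_def .
qed

lemma cmod_moment_le_1:
  assumes V: "V \<in> unitary_group N" and u: "u \<in> unit_vectors N" and z: "\<And>i. i < N \<Longrightarrow> cmod (z i) = 1"
  shows "cmod (moment (V * mat_diag N z * mat_adjoint V) u k) \<le> 1"
proof -
  have "cmod (\<Sum>i<N. of_real ((cmod (overlap V u i))\<^sup>2) * z i ^ k) \<le> (\<Sum>i<N. (cmod (overlap V u i))\<^sup>2)"
    by (rule sum_norm_le) (simp add: norm_mult norm_power z)
  then show ?thesis
    using V u by (simp add: moment_conj_diag unit_vectors_def overlap_sum_squares[OF V u])
qed

lemma cmod_deviation_le:
  assumes "cmod (moment A u k) \<le> 1"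
  shows "cmod (deviation N s A u k) \<le> sqrt (real N) + \<bar>s\<bar>"
proof -
  have "cmod (deviation N s A u k) \<le> cmod (of_real (sqrt (real N)) * moment A u k) + \<bar>s\<bar>"
    unfolding deviation_def by (rule order.trans[OF norm_triangle_ineq4]) auto
  also have "cmod (of_real (sqrt (real N)) * moment A u k) \<le> sqrt (real N) * 1"
    unfolding norm_mult using assms by (intro mult_mono) auto
  finally show ?thesis by simp
qed

lemma summable_deviation:
  assumes "\<And>k. cmod (moment A u k) \<le> 1" "0 \<le> \<rho>" "\<rho> < 1"
  shows "summable (\<lambda>j. \<rho> ^ Suc j * cmod (deviation N s A u (Suc j)))"
proof (rule summable_comparison_test')
  show "summable (\<lambda>j. \<rho> ^ Suc j * (sqrt (real N) + \<bar>s\<bar>))"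
    using assms by (intro summable_mult2) (simp add: summable_Suc_iff summable_geometric)
  show "norm (\<rho> ^ Suc j * cmod (deviation N s A u (Suc j))) \<le> \<rho> ^ Suc j * (sqrt (real N) + \<bar>s\<bar>)" for j
    using assms cmod_deviation_le[OF assms(1)[of "Suc j"], of N s]
    by (simp add: abs_mult mult_left_mono)
qed

text \<open>
  Up to the factor \<open>\<Prod>\<^sub>i (\<zeta> - z\<^sub>i)\<close>, which has no zero in the disk, \<open>sqrt N\<close> times the characteristic
  polynomial is the function \<open>t sqrt N - (1 - t) (s/2) \<zeta>\<^sup>2\<close>, with an error controlled by the total deviation.
\<close>
lemma poly_char_poly_approx:
  fixes t s \<rho> :: real
  assumes V: "V \<in> unitary_group N" and u: "u \<in> unit_vectors N" and z: "\<And>i. i < N \<Longrightarrow> cmod (z i) = 1"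
    and \<rho>: "\<rho> < 1" and \<zeta>: "cmod \<zeta> \<le> \<rho>"
  defines "M \<equiv> V * mat_diag N z * mat_adjoint V"
  shows "cmod (of_real (sqrt (real N)) *
        poly (char_poly (M * (1\<^sub>m N - of_real (1 - t) \<cdot>\<^sub>m proj_mat u))) \<zeta> +
        (of_real ((1 - t) * s / 2) * \<zeta>\<^sup>2 - of_real (t * sqrt (real N))) * (\<Prod>i<N. \<zeta> - z i)) \<le>
      cmod (\<Prod>i<N. \<zeta> - z i) * (\<bar>1 - t\<bar> * total_deviation N \<rho> s M u)"
proof -
  have u': "u \<in> carrier_vec N" using u by (simp add: unit_vectors_def)
  have \<rho>0: "0 \<le> \<rho>" using \<zeta> norm_ge_zero order.trans by blast
  have \<zeta>1: "cmod \<zeta> < 1" using \<zeta> \<rho> by simp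
  have ne: "\<zeta> \<noteq> z i" if "i < N" for i using z[OF that] \<zeta>1 by auto
  let ?p = "\<lambda>i. complex_of_real ((cmod (overlap V u i))\<^sup>2)"
  let ?q = "of_real (sqrt (real N)) :: complex"
  have sum_p: "(\<Sum>i<N. ?p i) = 1"
    using overlap_sum_squares[OF V u] by (metis of_real_1 of_real_sum)
  have m1: "cmod (moment M u k) \<le> 1" for k
    unfolding M_def by (rule cmod_moment_le_1[OF V u z])
  define h where "h = (\<Sum>i<N. ?p i * (- z i / (\<zeta> - z i) - 1))"
  have "(\<lambda>j. \<Sum>i<N. ?p i * (cnj (z i) * \<zeta>) ^ Suc j) sums h"
    unfolding h_def by (intro sums_sum sums_mult geometric_cauchy_kernel) (use z \<zeta>1 in auto)
  moreover have "(\<Sum>i<N. ?p i * (cnj (z i) * \<zeta>) ^ Suc j) = cnj (moment M u (Suc j)) * \<zeta> ^ Suc j" for j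
    unfolding M_def moment_conj_diag[OF V u']
    unfolding cnj_sum sum_distrib_right by (rule sum.cong) (simp_all add: power_mult_distrib mult_ac)
  ultimately have h_sums: "(\<lambda>j. cnj (moment M u (Suc j)) * \<zeta> ^ Suc j) sums h" by simp
  have "poly (char_poly (M * (1\<^sub>m N - of_real (1 - t) \<cdot>\<^sub>m proj_mat u))) \<zeta> =
      (\<Prod>i<N. \<zeta> - z i) * (1 + of_real (1 - t) * (\<Sum>i<N. ?p i * z i / (\<zeta> - z i)))"
    unfolding M_def by (rule char_poly_conj_rank_one[OF V u' ne])
  also have "(\<Sum>i<N. ?p i * z i / (\<zeta> - z i)) = - h - 1"
    unfolding h_def by (simp add: right_diff_distrib sum_subtractf sum_p sum_negf del: of_real_power)
  finally have chi: "poly (char_poly (M * (1\<^sub>m N - of_real (1 - t) \<cdot>\<^sub>m proj_mat u))) \<zeta> =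
      (\<Prod>i<N. \<zeta> - z i) * (of_real t - of_real (1 - t) * h)" by (simp add: algebra_simps)
  have "(\<lambda>j. cnj (deviation N s M u (Suc j)) * \<zeta> ^ Suc j) sums (?q * h - of_real (s / 2) * \<zeta>\<^sup>2)"
  proof -
    have "(\<lambda>j. if j = 1 then of_real (s / 2) * \<zeta>\<^sup>2 else 0) sums (of_real (s / 2) * \<zeta>\<^sup>2)"
      by (rule sums_single)
    from sums_diff[OF sums_mult[OF h_sums, of ?q] this] show ?thesis
      by (rule sums_cong[THEN iffD1, rotated]) (auto simp: deviation_def algebra_simps power2_eq_square)
  qed
  then have dev_sum: "?q * h - of_real (s / 2) * \<zeta>\<^sup>2 = (\<Sum>j. cnj (deviation N s M u (Suc j)) * \<zeta> ^ Suc j)"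
    by (simp add: sums_iff)
  have "cmod (\<Sum>j. cnj (deviation N s M u (Suc j)) * \<zeta> ^ Suc j) \<le> total_deviation N \<rho> s M u"
    unfolding total_deviation_def
  proof (rule norm_suminf_le)
    show "norm (cnj (deviation N s M u (Suc j)) * \<zeta> ^ Suc j) \<le> \<rho> ^ Suc j * cmod (deviation N s M u (Suc j))" for j
    proof -
      have "cmod \<zeta> ^ Suc j \<le> \<rho> ^ Suc j" using \<zeta> by (intro power_mono) auto
      then have "cmod (deviation N s M u (Suc j)) * cmod \<zeta> ^ Suc j \<le> cmod (deviation N s M u (Suc j)) * \<rho> ^ Suc j"
        by (rule mult_left_mono) simp
      then show ?thesis unfolding norm_mult norm_power complex_mod_cnj by (simp only: mult.commute)
    qed
    show "summable (\<lambda>j. \<rho> ^ Suc j * cmod (deviation N s M u (Suc j)))"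
      by (rule summable_deviation[OF m1 \<rho>0 \<rho>])
  qed
  then have T: "cmod (?q * h - of_real (s / 2) * \<zeta>\<^sup>2) \<le> total_deviation N \<rho> s M u"
    unfolding dev_sum .
  let ?P = "\<Prod>i<N. \<zeta> - z i"
  have "?q * (?P * (of_real t - of_real (1 - t) * h)) +
        (of_real ((1 - t) * s / 2) * \<zeta>\<^sup>2 - of_real (t * sqrt (real N))) * ?P =
      - (?P * (of_real (1 - t) * (?q * h - of_real (s / 2) * \<zeta>\<^sup>2)))"
    by (simp add: algebra_simps)
  also have "cmod \<dots> \<le> cmod ?P * (\<bar>1 - t\<bar> * total_deviation N \<rho> s M u)"
    unfolding norm_minus_cancel norm_mult[of ?P] norm_mult[of "of_real (1 - t)"] norm_of_real
    using T by (intro mult_left_mono) auto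
  finally show ?thesis unfolding chi .
qed

lemma eig_count_eq_sum_order:
  assumes "A \<in> carrier_mat N N"
  shows "eig_count A S = (\<Sum>z\<in>{z\<in>S. poly (char_poly A) z = 0}. order z (char_poly A))"
  unfolding eig_count_def spectrum_root_char_poly[OF assms] by (rule sum.cong) auto

text \<open>
  The constant term \<open>t sqrt N\<close> dominates.
\<close>
lemma eig_count_eq_0:
  fixes t \<rho> :: real
  assumes V: "V \<in> unitary_group N" and u: "u \<in> unit_vectors N" and z: "\<And>i. i < N \<Longrightarrow> cmod (z i) = 1"
    and \<rho>: "0 < \<rho>" "\<rho> < 1"
  defines "M \<equiv> V * mat_diag N z * mat_adjoint V"
  assumes small: "\<bar>1 - t\<bar> * total_deviation N \<rho> 0 M u < \<bar>t\<bar> * sqrt (real N)"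
  shows "eig_count (M * (1\<^sub>m N - of_real (1 - t) \<cdot>\<^sub>m proj_mat u)) (ball 0 \<rho>) = 0"
proof -
  let ?G = "M * (1\<^sub>m N - of_real (1 - t) \<cdot>\<^sub>m proj_mat u)"
  have M: "M \<in> carrier_mat N N"
    unfolding M_def by (rule mult_carrier_mat[OF mult_carrier_mat[OF unitary_groupD(1)[OF V] mat_diag_dim] unitary_groupD(2)[OF V]])
  have "1\<^sub>m N - complex_of_real (1 - t) \<cdot>\<^sub>m proj_mat u \<in> carrier_mat N N"
    using u by (auto simp: proj_mat_def unit_vectors_def)
  with M have G: "?G \<in> carrier_mat N N" by (rule mult_carrier_mat)
  have "poly (char_poly ?G) \<zeta> \<noteq> 0" if \<zeta>: "\<zeta> \<in> ball 0 \<rho>" for \<zeta>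
  proof
    let ?P = "\<Prod>i<N. \<zeta> - z i"
    assume "poly (char_poly ?G) \<zeta> = 0"
    then have "cmod ?P * (\<bar>t\<bar> * sqrt (real N)) \<le> cmod ?P * (\<bar>1 - t\<bar> * total_deviation N \<rho> 0 M u)"
      using poly_char_poly_approx[where z = z and \<zeta> = \<zeta> and t = t and s = 0, OF V u z \<rho>(2)] \<zeta>
      by (simp add: M_def norm_mult abs_mult mult_ac)
    moreover have "cmod ?P > 0" using z \<zeta> \<rho> by (auto simp: zero_less_norm_iff)
    ultimately show False using small by (simp add: mult_le_cancel_left)
  qed
  then show ?thesis unfolding eig_count_eq_sum_order[OF G] by (intro sum.neutral) blast
qed

text \<open>
  The quadratic term dominates, and contributes a double zero at the origin.
\<close>
lemma eig_count_eq_2: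
  fixes t s \<rho> :: real
  assumes V: "V \<in> unitary_group N" and u: "u \<in> unit_vectors N" and z: "\<And>i. i < N \<Longrightarrow> cmod (z i) = 1"
    and \<rho>: "0 < \<rho>" "\<rho> < 1" and t: "t < 1" and N: "N \<ge> 1"
  defines "M \<equiv> V * mat_diag N z * mat_adjoint V"
  assumes large: "\<bar>t\<bar> * sqrt (real N) + (1 - t) * total_deviation N \<rho> s M u < (1 - t) * s / 2 * \<rho>\<^sup>2"
  shows "eig_count (M * (1\<^sub>m N - of_real (1 - t) \<cdot>\<^sub>m proj_mat u)) (ball 0 \<rho>) = 2"
proof -
  let ?G = "M * (1\<^sub>m N - of_real (1 - t) \<cdot>\<^sub>m proj_mat u)"
  have M: "M \<in> carrier_mat N N"
    unfolding M_def by (rule mult_carrier_mat[OF mult_carrier_mat[OF unitary_groupD(1)[OF V] mat_diag_dim] unitary_groupD(2)[OF V]])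
  have "1\<^sub>m N - complex_of_real (1 - t) \<cdot>\<^sub>m proj_mat u \<in> carrier_mat N N"
    using u by (auto simp: proj_mat_def unit_vectors_def)
  with M have G: "?G \<in> carrier_mat N N" by (rule mult_carrier_mat)
  define \<Lambda> where "\<Lambda> = (\<Prod>i<N. [:- z i, 1:])"
  define c where "c = complex_of_real ((1 - t) * s / 2)"
  define p where "p = monom (- c) 2 * \<Lambda>"
  define q where "q = Polynomial.smult (of_real (sqrt (real N))) (char_poly ?G) - p"
  have \<Lambda>: "poly \<Lambda> \<zeta> = (\<Prod>i<N. \<zeta> - z i)" for \<zeta> by (simp add: \<Lambda>_def poly_prod)
  have \<Lambda>0: "poly \<Lambda> \<zeta> \<noteq> 0" if "cmod \<zeta> < 1" for \<zeta>
    unfolding \<Lambda> using z that by auto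
  have "0 \<le> total_deviation N \<rho> s M u"
    unfolding total_deviation_def M_def
    using \<rho> by (intro suminf_nonneg summable_deviation cmod_moment_le_1[OF V u z]) auto
  then have cpos: "(1 - t) * s / 2 > 0"
    using large \<rho> t
    by (smt (verit) mult_nonneg_nonneg real_sqrt_ge_zero of_nat_0_le_iff zero_less_mult_pos2 zero_less_power abs_ge_zero)
  then have c0: "c \<noteq> 0" unfolding c_def of_real_eq_0_iff by linarith
  have "p \<noteq> 0" using \<Lambda>0[of 0] c0 by (auto simp: p_def monom_eq_0_iff)
  have less: "cmod (poly q \<zeta>) < cmod (poly p \<zeta>)" if \<zeta>: "cmod \<zeta> = \<rho>" for \<zeta>
  proof -
    let ?P = "\<Prod>i<N. \<zeta> - z i"
    let ?e = "of_real (sqrt (real N)) * poly (char_poly ?G) \<zeta> + (c * \<zeta>\<^sup>2 - of_real (t * sqrt (real N))) * ?P"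
    have "poly q \<zeta> = ?e + of_real (t * sqrt (real N)) * ?P"
      by (simp add: q_def p_def poly_monom \<Lambda> algebra_simps)
    then have "cmod (poly q \<zeta>) \<le> cmod ?e + cmod (of_real (t * sqrt (real N)) * ?P)"
      by (simp only: norm_triangle_ineq)
    also have "\<dots> \<le> cmod ?P * (\<bar>1 - t\<bar> * total_deviation N \<rho> s M u) + cmod ?P * (\<bar>t\<bar> * sqrt (real N))"
    proof (rule add_mono)
      show "cmod ?e \<le> cmod ?P * (\<bar>1 - t\<bar> * total_deviation N \<rho> s M u)"
        unfolding c_def M_def using poly_char_poly_approx[where z = z and \<zeta> = \<zeta> and t = t and s = s, OF V u z \<rho>(2)] \<zeta>
        by (simp only: order_refl)
    qed (simp add: norm_mult abs_mult)
    also have "\<dots> = cmod ?P * (\<bar>t\<bar> * sqrt (real N) + \<bar>1 - t\<bar> * total_deviation N \<rho> s M u)"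
      by (simp add: algebra_simps)
    also have "\<dots> < cmod (\<Prod>i<N. \<zeta> - z i) * ((1 - t) * s / 2 * \<rho>\<^sup>2)"
      using large t \<Lambda>0[of \<zeta>] \<zeta> \<rho> unfolding \<Lambda> by (intro mult_strict_left_mono) auto
    also have "\<dots> = cmod (poly p \<zeta>)"
    proof -
      have "cmod c = (1 - t) * s / 2" unfolding c_def norm_of_real using cpos by simp
      then show ?thesis by (simp add: p_def poly_monom \<Lambda> norm_mult norm_power \<zeta>)
    qed
    finally show ?thesis .
  qed
  have "eig_count ?G (ball 0 \<rho>) = (\<Sum>\<zeta>\<in>{\<zeta>\<in>ball 0 \<rho>. poly (p + q) \<zeta> = 0}. order \<zeta> (p + q))"
    using N unfolding eig_count_eq_sum_order[OF G] q_def by (simp add: order_smult)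
  also have "\<dots> = (\<Sum>\<zeta>\<in>{\<zeta>\<in>ball 0 \<rho>. poly p \<zeta> = 0}. order \<zeta> p)"
    by (rule polynomial_Rouche[OF \<rho>(1) less])
  also have "{\<zeta>\<in>ball 0 \<rho>. poly p \<zeta> = 0} = {0}"
    using \<rho> \<Lambda>0 c0 by (auto simp: p_def poly_monom)
  also have "(\<Sum>\<zeta>\<in>{0}. order \<zeta> p) = 2"
    using order_mult[of "monom (- c) 2" \<Lambda> 0] \<open>p \<noteq> 0\<close> c0 \<Lambda>0[of 0]
    by (simp add: p_def order_0_monom order_0I)
  finally show ?thesis .
qed

section \<open>Bounded random variables\<close>

text \<open>
  All random variables below are bounded, and bounded functions form an algebra; this disposes of
  every integrability condition.
\<close>
definition bounded_rv :: "'a measure \<Rightarrow> ('a \<Rightarrow> 'b :: {banach, second_countable_topology}) \<Rightarrow> bool" where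
  "bounded_rv M f \<longleftrightarrow> f \<in> borel_measurable M \<and> (\<exists>B. \<forall>x\<in>space M. norm (f x) \<le> B)"

lemma bounded_rvI:
  "f \<in> borel_measurable M \<Longrightarrow> (\<And>x. x \<in> space M \<Longrightarrow> norm (f x) \<le> B) \<Longrightarrow> bounded_rv M f"
  unfolding bounded_rv_def by blast

lemma bounded_rv_measurable: "bounded_rv M f \<Longrightarrow> f \<in> borel_measurable M"
  unfolding bounded_rv_def by blast

lemma (in finite_measure) bounded_rv_integrable: "bounded_rv M f \<Longrightarrow> integrable M f"
  unfolding bounded_rv_def by (blast intro: integrable_const_bound)

lemma bounded_rv_const [intro, simp]: "bounded_rv M (\<lambda>_. c)"
  by (rule bounded_rvI[where B = "norm c"]) auto

lemma bounded_rv_add [intro]: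
  assumes "bounded_rv M f" "bounded_rv M g"
  shows "bounded_rv M (\<lambda>x. f x + g x)"
proof -
  obtain A B where "\<forall>x\<in>space M. norm (f x) \<le> A" "\<forall>x\<in>space M. norm (g x) \<le> B"
    using assms unfolding bounded_rv_def by blast
  then show ?thesis
    using assms by (intro bounded_rvI[where B = "A + B"]) (auto simp: bounded_rv_def intro: norm_triangle_mono)
qed

lemma bounded_rv_comp:
  assumes f: "bounded_rv M f" and h: "continuous_on UNIV h" "\<And>B. \<exists>C. \<forall>y. norm y \<le> B \<longrightarrow> norm (h y) \<le> C"
  shows "bounded_rv M (\<lambda>x. h (f x))"
proof -
  obtain A where A: "\<forall>x\<in>space M. norm (f x) \<le> A" using f unfolding bounded_rv_def by blast
  obtain C where "\<forall>y. norm y \<le> A \<longrightarrow> norm (h y) \<le> C" using h(2) by blast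
  with A show ?thesis
    using bounded_rv_measurable[OF f] borel_measurable_continuous_onI[OF h(1)]
    by (intro bounded_rvI[where B = C]) (auto intro: measurable_compose)
qed

lemma bounded_rv_minus [intro]: "bounded_rv M f \<Longrightarrow> bounded_rv M (\<lambda>x. - f x)"
  by (rule bounded_rv_comp) (auto intro!: continuous_intros)

lemma bounded_rv_diff [intro]: "bounded_rv M f \<Longrightarrow> bounded_rv M g \<Longrightarrow> bounded_rv M (\<lambda>x. f x - g x)"
  using bounded_rv_add[OF _ bounded_rv_minus, of M f g] by simp

lemma bounded_rv_mult [intro]:
  fixes f g :: "'a \<Rightarrow> 'b :: {real_normed_field, banach, second_countable_topology}"
  assumes "bounded_rv M f" "bounded_rv M g"
  shows "bounded_rv M (\<lambda>x. f x * g x)"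
proof -
  obtain A B where AB: "\<forall>x\<in>space M. norm (f x) \<le> A" "\<forall>x\<in>space M. norm (g x) \<le> B"
    using assms unfolding bounded_rv_def by blast
  show ?thesis
  proof (rule bounded_rvI[where B = "\<bar>A\<bar> * \<bar>B\<bar>"])
    show "norm (f x * g x) \<le> \<bar>A\<bar> * \<bar>B\<bar>" if "x \<in> space M" for x
      unfolding norm_mult using AB that by (intro mult_mono) force+
  qed (intro borel_measurable_times bounded_rv_measurable assms)
qed

lemma bounded_rv_power [intro]:
  fixes f :: "'a \<Rightarrow> 'b :: {real_normed_field, banach, second_countable_topology}"
  shows "bounded_rv M f \<Longrightarrow> bounded_rv M (\<lambda>x. f x ^ n)"
  by (induction n) auto

lemma bounded_rv_sum [intro]:
  "(\<And>i. i \<in> I \<Longrightarrow> bounded_rv M (f i)) \<Longrightarrow> bounded_rv M (\<lambda>x. \<Sum>i\<in>I. f i x)"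
  by (induction I rule: infinite_finite_induct) auto

lemma bounded_rv_prod [intro]:
  fixes f :: "'i \<Rightarrow> 'a \<Rightarrow> 'b :: {real_normed_field, banach, second_countable_topology}"
  shows "(\<And>i. i \<in> I \<Longrightarrow> bounded_rv M (f i)) \<Longrightarrow> bounded_rv M (\<lambda>x. \<Prod>i\<in>I. f i x)"
  by (induction I rule: infinite_finite_induct) auto

lemma bounded_rv_norm [intro]: "bounded_rv M f \<Longrightarrow> bounded_rv M (\<lambda>x. norm (f x))"
  by (rule bounded_rv_comp) (auto intro!: continuous_intros)

lemma bounded_rv_cnj [intro]: "bounded_rv M f \<Longrightarrow> bounded_rv M (\<lambda>x. cnj (f x))"
  by (rule bounded_rv_comp) (auto intro!: continuous_intros)

lemma bounded_rv_Re [intro]: "bounded_rv M f \<Longrightarrow> bounded_rv M (\<lambda>x. Re (f x))"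
  by (rule bounded_rv_comp) (auto intro!: continuous_intros intro: order.trans[OF abs_Re_le_cmod])

lemma bounded_rv_of_real [intro]: "bounded_rv M f \<Longrightarrow> bounded_rv M (\<lambda>x. complex_of_real (f x))"
  by (rule bounded_rv_comp) (auto intro!: continuous_intros)

section \<open>The unitary group and its Borel structure\<close>

lemma borel_mat_entry [measurable]:
  assumes "i < N" "j < N"
  shows "(\<lambda>A. A $$ (i, j)) \<in> borel_measurable (borel_mat N)"
proof -
  have "(\<lambda>A. \<lambda>ij\<in>{..<N} \<times> {..<N}. A $$ ij) \<in> measurable (borel_mat N) (PiM ({..<N} \<times> {..<N}) (\<lambda>_. borel))"
    unfolding borel_mat_def by (rule measurable_vimage_algebra1) (auto simp: space_PiM)
  then have "(\<lambda>A. (\<lambda>ij\<in>{..<N} \<times> {..<N}. A $$ ij) (i, j)) \<in> borel_measurable (borel_mat N)"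
    by (rule measurable_compose[OF _ measurable_component_singleton]) (use assms in auto)
  then show ?thesis using assms by simp
qed

lemma borel_vec_entry [measurable]:
  assumes "i < N"
  shows "(\<lambda>v. v $ i) \<in> borel_measurable (borel_vec N)"
proof -
  have "(\<lambda>v. \<lambda>i\<in>{..<N}. v $ i) \<in> measurable (borel_vec N) (PiM {..<N} (\<lambda>_. borel))"
    unfolding borel_vec_def by (rule measurable_vimage_algebra1) (auto simp: space_PiM)
  then have "(\<lambda>v. (\<lambda>i\<in>{..<N}. v $ i) i) \<in> borel_measurable (borel_vec N)"
    by (rule measurable_compose[OF _ measurable_component_singleton]) (use assms in auto)
  then show ?thesis using assms by simp
qed

lemma space_borel_mat [simp]: "space (borel_mat N) = carrier_mat N N"
  by (simp add: borel_mat_def)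

lemma space_borel_vec [simp]: "space (borel_vec N) = carrier_vec N"
  by (simp add: borel_vec_def)

lemma unitary_group_subset: "unitary_group N \<subseteq> carrier_mat N N"
  by (auto simp: unitary_group_def)

lemma space_borel_unitary [simp]: "space (borel_unitary N) = unitary_group N"
  using unitary_group_subset by (auto simp: borel_unitary_def space_restrict_space)

lemma borel_unitary_entry:
  "i < N \<Longrightarrow> j < N \<Longrightarrow> (\<lambda>A. A $$ (i, j)) \<in> borel_measurable (borel_unitary N)"
  unfolding borel_unitary_def by (intro measurable_restrict_space1 borel_mat_entry)

lemma measurable_borel_mat:
  assumes "\<And>x. x \<in> space L \<Longrightarrow> f x \<in> carrier_mat N N"
    and "\<And>i j. i < N \<Longrightarrow> j < N \<Longrightarrow> (\<lambda>x. f x $$ (i, j)) \<in> borel_measurable L"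
  shows "f \<in> measurable L (borel_mat N)"
  unfolding borel_mat_def
proof (rule measurable_vimage_algebra2)
  show "(\<lambda>x. \<lambda>ij\<in>{..<N} \<times> {..<N}. f x $$ ij) \<in> measurable L (PiM ({..<N} \<times> {..<N}) (\<lambda>_. borel))"
    by (rule measurable_restrict) (use assms(2) in auto)
qed (use assms(1) in auto)

lemma measurable_borel_unitary:
  assumes "\<And>x. x \<in> space L \<Longrightarrow> f x \<in> unitary_group N"
    and "\<And>i j. i < N \<Longrightarrow> j < N \<Longrightarrow> (\<lambda>x. f x $$ (i, j)) \<in> borel_measurable L"
  shows "f \<in> measurable L (borel_unitary N)"
  unfolding borel_unitary_def
  using assms unitary_group_subset by (intro measurable_restrict_space2 measurable_borel_mat) blast+

lemma mat_mult_entry: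
  assumes "A \<in> carrier_mat n m" "B \<in> carrier_mat m l" "i < n" "j < l"
  shows "(A * B) $$ (i, j) = (\<Sum>k<m. A $$ (i, k) * B $$ (k, j))"
  using assms by (simp add: scalar_prod_def atLeast0LessThan)

lemma adjoint_mult:
  fixes A B :: "complex Matrix.mat"
  assumes "A \<in> carrier_mat n m" "B \<in> carrier_mat m l"
  shows "mat_adjoint (A * B) = mat_adjoint B * mat_adjoint A"
  by (rule eq_matI) (use assms in \<open>auto simp: scalar_prod_def mult.commute\<close>)

lemma unitary_group_adjoint: "U \<in> unitary_group N \<Longrightarrow> mat_adjoint U \<in> unitary_group N"
  unfolding unitary_group_def mem_Collect_eq mat_adjoint_adjoint
  using unitary_groupD(2,4)[of U N, unfolded unitary_group_def mem_Collect_eq] by blast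

lemma unitary_group_mult:
  assumes "U \<in> unitary_group N" "V \<in> unitary_group N"
  shows "U * V \<in> unitary_group N"
proof -
  note U = unitary_groupD[OF assms(1)] and V = unitary_groupD[OF assms(2)]
  have UV: "U * V \<in> carrier_mat N N" by (rule mult_carrier_mat[OF U(1) V(1)])
  have "U * V * mat_adjoint (U * V) = U * V * (mat_adjoint V * mat_adjoint U)"
    by (simp only: adjoint_mult[OF U(1) V(1)])
  also have "\<dots> = U * (V * (mat_adjoint V * mat_adjoint U))"
    by (rule assoc_mult_mat[OF U(1) V(1) mult_carrier_mat[OF V(2) U(2)]])
  also have "V * (mat_adjoint V * mat_adjoint U) = mat_adjoint U"
    using assoc_mult_mat[OF V(1,2) U(2)] V(3) left_mult_one_mat[OF U(2)] by simp
  finally show ?thesis using UV U(3) by (simp add: unitary_group_def)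
qed

lemma unitary_column_sum_squares:
  assumes "V \<in> unitary_group N" "i < N"
  shows "(\<Sum>k<N. (cmod (V $$ (k, i)))\<^sup>2) = 1"
proof -
  note V = unitary_groupD[OF assms(1)]
  have "of_real (\<Sum>k<N. (cmod (V $$ (k, i)))\<^sup>2) = (\<Sum>k<N. cnj (V $$ (k, i)) * V $$ (k, i))"
    unfolding of_real_sum complex_norm_square by (simp add: mult.commute)
  also have "\<dots> = (mat_adjoint V * V) $$ (i, i)"
    using V(1,2) assms(2) by (subst mat_mult_entry[OF V(2,1)]) auto
  also have "\<dots> = 1" using V(4) assms(2) by simp
  finally show ?thesis by (simp only: of_real_eq_1_iff)
qed

lemma unitary_entry_le_1:
  assumes "V \<in> unitary_group N" "k < N" "i < N"
  shows "cmod (V $$ (k, i)) \<le> 1"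
proof -
  have "(cmod (V $$ (k, i)))\<^sup>2 \<le> (\<Sum>k<N. (cmod (V $$ (k, i)))\<^sup>2)"
    by (rule member_le_sum) (use assms in auto)
  then show ?thesis
    unfolding unitary_column_sum_squares[OF assms(1,3)] by (simp add: power_le_one_iff)
qed

text \<open>
  A Householder reflection exchanges \<open>u\<close> and \<open>\<phi> w\<close> as soon as their inner product is real. With the
  phase that makes it nonpositive, the axis \<open>u - \<phi> w\<close> of the reflection cannot vanish. The result is
  applied to functions that are insensitive to the phase.
\<close>
lemma unitary_between_unit_vectors:
  assumes u: "u \<in> unit_vectors N" and w: "w \<in> unit_vectors N"
  shows "\<exists>U\<in>unitary_group N. \<exists>\<phi>. cmod \<phi> = 1 \<and> U *\<^sub>v u = \<phi> \<cdot>\<^sub>v w"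
proof -
  have u': "u \<in> carrier_vec N" "(\<Sum>k<N. u $ k * cnj (u $ k)) = 1"
    and w': "w \<in> carrier_vec N" "(\<Sum>k<N. w $ k * cnj (w $ k)) = 1"
    using u w by (auto simp: unit_vectors_def scalar_prod_def atLeast0LessThan)
  define p where "p = (\<Sum>k<N. u $ k * cnj (w $ k))"
  \<comment> \<open>makes \<open>cnj \<phi> * p = - cmod p\<close>\<close>
  define \<phi> where "\<phi> = (if p = 0 then 1 else - sgn p)"
  have \<phi>: "cmod \<phi> = 1" "cnj \<phi> * \<phi> = 1" "cnj \<phi> * p = - of_real (cmod p)" "\<phi> * cnj p = - of_real (cmod p)"
  proof -
    show 1: "cmod \<phi> = 1" by (auto simp: \<phi>_def norm_sgn)
    then show "cnj \<phi> * \<phi> = 1" by (metis complex_norm_square mult.commute of_real_1 one_power2)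
    have "cnj (sgn p) * p = of_real (cmod p)"
    proof (cases "p = 0")
      case False
      have "cnj (sgn p) * p = (p * cnj p) / of_real (cmod p)" by (simp add: sgn_eq)
      also have "\<dots> = of_real (cmod p)" using False
        by (simp add: complex_norm_square[symmetric] power2_eq_square del: of_real_power)
      finally show ?thesis .
    qed simp
    then show 3: "cnj \<phi> * p = - of_real (cmod p)" by (simp add: \<phi>_def)
    show "\<phi> * cnj p = - of_real (cmod p)" using arg_cong[OF 3, of cnj] by simp
  qed
  define r where "r = 1 + cmod p"
  have r: "complex_of_real r \<noteq> 0" unfolding r_def of_real_eq_0_iff by (smt (verit) norm_ge_zero)
  define x where "x = (\<lambda>k. u $ k - \<phi> * w $ k)"
  have xu: "(\<Sum>k<N. cnj (x k) * u $ k) = of_real r"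
  proof -
    have "(\<Sum>k<N. cnj (x k) * u $ k) = (\<Sum>k<N. u $ k * cnj (u $ k)) - cnj \<phi> * p"
      unfolding x_def p_def sum_distrib_left sum_subtractf[symmetric] by (rule sum.cong) (auto simp: algebra_simps)
    then show ?thesis by (simp add: u' \<phi> r_def)
  qed
  have xx: "(\<Sum>k<N. cnj (x k) * x k) = 2 * of_real r"
  proof -
    have "(\<Sum>k<N. cnj (x k) * w $ k) = cnj p - cnj \<phi> * (\<Sum>k<N. w $ k * cnj (w $ k))"
      unfolding x_def p_def sum_distrib_left cnj_sum sum_subtractf[symmetric] by (rule sum.cong) (auto simp: algebra_simps)
    then have "\<phi> * (\<Sum>k<N. cnj (x k) * w $ k) = - of_real r"
      using \<phi>(2,4) by (simp add: w' r_def right_diff_distrib mult.commute[of \<phi> "cnj \<phi>"])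
    moreover have "(\<Sum>k<N. cnj (x k) * x k) = (\<Sum>k<N. cnj (x k) * u $ k) - \<phi> * (\<Sum>k<N. cnj (x k) * w $ k)"
      unfolding sum_distrib_left sum_subtractf[symmetric] by (rule sum.cong) (auto simp: x_def algebra_simps)
    ultimately show ?thesis using xu by simp
  qed
  define U where "U = Matrix.mat N N (\<lambda>(i, j). (if i = j then 1 else 0) - x i * cnj (x j) / of_real r)"
  have U: "U \<in> carrier_mat N N" by (simp add: U_def)
  have "U * mat_adjoint U = 1\<^sub>m N"
  proof (rule eq_matI)
    fix i j assume ij: "i < dim_row (1\<^sub>m N :: complex Matrix.mat)" "j < dim_col (1\<^sub>m N :: complex Matrix.mat)"
    then have ij: "i < N" "j < N" by auto
    have "(U * mat_adjoint U) $$ (i, j) = (\<Sum>k<N. U $$ (i, k) * cnj (U $$ (j, k)))"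
      using ij U by (simp add: scalar_prod_def atLeast0LessThan)
    also have "\<dots> = (\<Sum>k<N. (if i = k then (if j = k then 1 else 0) - cnj (x j) * x k / of_real r else 0)
        - (if j = k then x i * cnj (x k) / of_real r else 0)
        + x i * cnj (x j) / (of_real r)\<^sup>2 * (cnj (x k) * x k))"
      by (rule sum.cong) (use ij in \<open>auto simp: U_def power2_eq_square algebra_simps\<close>)
    also have "\<dots> = (if i = j then 1 else 0) - x i * cnj (x j) / of_real r - x i * cnj (x j) / of_real r
        + x i * cnj (x j) / (of_real r)\<^sup>2 * (2 * of_real r)"
      unfolding sum.distrib sum_subtractf sum_distrib_left[symmetric] xx using ij by (simp add: mult.commute)
    also have "\<dots> = (if i = j then 1 else 0)" using r by (simp add: field_simps power2_eq_square)
    finally show "(U * mat_adjoint U) $$ (i, j) = 1\<^sub>m N $$ (i, j)" using ij by simp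
  qed (use U in auto)
  then have "U \<in> unitary_group N" using U by (simp add: unitary_group_def)
  moreover have "U *\<^sub>v u = \<phi> \<cdot>\<^sub>v w"
  proof (rule eq_vecI)
    fix i assume "i < dim_vec (\<phi> \<cdot>\<^sub>v w)"
    then have i: "i < N" using w' by simp
    have "(U *\<^sub>v u) $ i = (\<Sum>k<N. (if i = k then u $ k else 0) - x i / of_real r * (cnj (x k) * u $ k))"
      using i U u' unfolding index_mult_mat_vec[OF i[folded carrier_matD(1)[OF U]]] scalar_prod_def
      by (auto simp: U_def atLeast0LessThan algebra_simps intro!: sum.cong)
    also have "\<dots> = u $ i - x i / of_real r * of_real r"
      unfolding sum_subtractf sum_distrib_left[symmetric] xu using i by simp
    also have "\<dots> = (\<phi> \<cdot>\<^sub>v w) $ i" using r i w' by (simp add: x_def)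
    finally show "(U *\<^sub>v u) $ i = (\<phi> \<cdot>\<^sub>v w) $ i" .
  qed (use U w' in auto)
  ultimately show ?thesis using \<phi>(1) by blast
qed

section \<open>Fourth moments of Haar unitary columns\<close>

lemma haar_prob_space: "haar_unitary N \<mu> \<Longrightarrow> prob_space \<mu>"
  by (simp add: haar_unitary_def)

lemma haar_space: "haar_unitary N \<mu> \<Longrightarrow> space \<mu> = unitary_group N"
  unfolding haar_unitary_def by (metis sets_eq_imp_space_eq space_borel_unitary)

lemma haar_measurable:
  "haar_unitary N \<mu> \<Longrightarrow> f \<in> measurable (borel_unitary N) L \<Longrightarrow> f \<in> measurable \<mu> L"
  unfolding haar_unitary_def using measurable_cong_sets by blast

lemma haar_entry_bounded:
  assumes "haar_unitary N \<mu>" "k < N" "i < N"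
  shows "bounded_rv \<mu> (\<lambda>V. V $$ (k, i))"
  using assms borel_unitary_entry[of k N i]
  by (intro bounded_rvI[where B = 1])
     (auto simp: haar_space intro: haar_measurable unitary_entry_le_1)

lemma unitary_mult_measurable:
  assumes U: "U \<in> unitary_group N"
  shows "(\<lambda>V. U * V) \<in> measurable (borel_unitary N) (borel_unitary N)"
proof (rule measurable_borel_unitary)
  fix i j assume ij: "i < N" "j < N"
  have "(\<lambda>V. \<Sum>k<N. U $$ (i, k) * V $$ (k, j)) \<in> borel_measurable (borel_unitary N)"
    using ij by (intro borel_measurable_sum borel_measurable_times borel_unitary_entry) auto
  then show "(\<lambda>V. (U * V) $$ (i, j)) \<in> borel_measurable (borel_unitary N)"
    by (rule measurable_cong[THEN iffD1, rotated])
       (simp add: mat_mult_entry[OF unitary_groupD(1)[OF U] unitary_groupD(1) ij])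
qed (use unitary_group_mult[OF U] in simp)

lemma haar_integral_translate:
  fixes f :: "complex Matrix.mat \<Rightarrow> real"
  assumes \<mu>: "haar_unitary N \<mu>" and U: "U \<in> unitary_group N" and f: "f \<in> borel_measurable \<mu>"
  shows "(\<integral>V. f (U * V) \<partial>\<mu>) = (\<integral>V. f V \<partial>\<mu>)"
proof -
  have sets: "sets \<mu> = sets (borel_unitary N)"
    and inv: "distr \<mu> (borel_unitary N) (\<lambda>W. U * W) = \<mu>"
    using \<mu> U by (auto simp: haar_unitary_def)
  have "(\<integral>V. f V \<partial>distr \<mu> (borel_unitary N) (\<lambda>W. U * W)) = (\<integral>V. f (U * V) \<partial>\<mu>)"
    by (rule integral_distr)
       (use haar_measurable[OF \<mu> unitary_mult_measurable[OF U]] f measurable_cong_sets[OF sets refl] in auto)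
  then show ?thesis by (simp add: inv)
qed

lemma parallelogram_fourth_power:
  fixes x y :: complex
  shows "(cmod (x + y) ^ 4 + cmod (x - y) ^ 4) / 2 \<le> cmod x ^ 4 + 6 * ((cmod x)\<^sup>2 * (cmod y)\<^sup>2) + cmod y ^ 4"
proof -
  define r where "r = Re (x * cnj y)"
  have plus: "(cmod (x + y))\<^sup>2 = (cmod x)\<^sup>2 + (cmod y)\<^sup>2 + 2 * r"
    and minus: "(cmod (x - y))\<^sup>2 = (cmod x)\<^sup>2 + (cmod y)\<^sup>2 - 2 * r"
    unfolding cmod_power2 r_def by (simp_all add: power2_eq_square algebra_simps)
  have "\<bar>r\<bar> \<le> cmod x * cmod y"
    unfolding r_def by (metis abs_Re_le_cmod complex_mod_cnj norm_mult)
  then have r2: "r\<^sup>2 \<le> (cmod x)\<^sup>2 * (cmod y)\<^sup>2"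
    by (metis abs_ge_zero power2_abs power_mono power_mult_distrib)
  have four: "a ^ 4 = (a\<^sup>2)\<^sup>2" for a :: real by (simp flip: power_mult)
  show ?thesis
    unfolding four plus minus using r2 by (simp add: power2_eq_square algebra_simps)
qed

lemma parallelogram_sq:
  fixes x y :: complex
  shows "((cmod (x + y))\<^sup>2 + (cmod (x - y))\<^sup>2) / 2 = (cmod x)\<^sup>2 + (cmod y)\<^sup>2"
  unfolding cmod_power2 by (simp add: power2_eq_square algebra_simps)

definition column_sum :: "nat \<Rightarrow> nat \<Rightarrow> complex Matrix.mat \<Rightarrow> complex" where
  "column_sum j n V = (\<Sum>k<n. V $$ (k, j))"

definition column_mass :: "nat \<Rightarrow> nat \<Rightarrow> complex Matrix.mat \<Rightarrow> real" where
  "column_mass j n V = (\<Sum>k<n. (cmod (V $$ (k, j)))\<^sup>2)"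

context
  fixes N i :: nat and \<mu> :: "complex Matrix.mat measure"
  assumes \<mu>: "haar_unitary N \<mu>" and i: "i < N"
begin

interpretation prob_space \<mu> using haar_prob_space[OF \<mu>] .

lemma entry_bounded: "k < N \<Longrightarrow> bounded_rv \<mu> (\<lambda>V. V $$ (k, i))"
  by (rule haar_entry_bounded[OF \<mu> _ i])

lemma column_bounded:
  assumes "n \<le> N"
  shows "bounded_rv \<mu> (column_sum i n)" "bounded_rv \<mu> (column_mass i n)"
  unfolding column_sum_def[abs_def] column_mass_def[abs_def]
  using assms by (auto intro!: bounded_rv_sum bounded_rv_power bounded_rv_norm entry_bounded)

text \<open>
  Left multiplication by a diagonal matrix of signs preserves Haar measure. The map \<open>g\<close> describes \<open>f\<close>
  after the flip, through the entries of the \<open>i\<close>-th column only.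
\<close>
lemma haar_sign_flip:
  fixes f g :: "complex Matrix.mat \<Rightarrow> real"
  assumes m: "m < N" and f: "f \<in> borel_measurable \<mu>"
    and g: "\<And>V W. V \<in> unitary_group N \<Longrightarrow> W \<in> carrier_mat N N \<Longrightarrow>
      (\<And>k. k < N \<Longrightarrow> W $$ (k, i) = (if k = m then - V $$ (k, i) else V $$ (k, i))) \<Longrightarrow> f W = g V"
  shows "(\<integral>V. f V \<partial>\<mu>) = (\<integral>V. g V \<partial>\<mu>)"
proof -
  let ?F = "mat_diag N (\<lambda>k. if k = m then - 1 else 1 :: complex)"
  have "mat_adjoint ?F = ?F" by (rule eq_matI) (auto simp: mat_diag_def)
  then have "?F * mat_adjoint ?F = 1\<^sub>m N"
    by (simp add: if_distrib cong: if_cong)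
  then have F: "?F \<in> unitary_group N" by (simp add: unitary_group_def)
  have "(\<integral>V. f V \<partial>\<mu>) = (\<integral>V. f (?F * V) \<partial>\<mu>)"
    using haar_integral_translate[OF \<mu> F f] by simp
  also have "\<dots> = (\<integral>V. g V \<partial>\<mu>)"
  proof (rule Bochner_Integration.integral_cong[OF refl])
    fix V assume "V \<in> space \<mu>"
    then have V: "V \<in> unitary_group N" by (simp add: haar_space[OF \<mu>])
    note Vc = unitary_groupD(1)[OF V]
    show "f (?F * V) = g V"
    proof (rule g[OF V])
      show "?F * V \<in> carrier_mat N N" by (rule mult_carrier_mat[OF mat_diag_dim Vc])
      show "(?F * V) $$ (k, i) = (if k = m then - V $$ (k, i) else V $$ (k, i))" if "k < N" for k
        unfolding mat_diag_mult_left[OF Vc] using that i by simp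
    qed
  qed
  finally show ?thesis .
qed

text \<open>
  Averaging over the sign of each new entry removes the cross terms.
\<close>
lemma haar_sum_times_entry:
  assumes "n \<le> m" "m < N"
  shows "(\<integral>V. (cmod (column_sum i n V))\<^sup>2 * (cmod (V $$ (m, i)))\<^sup>2 \<partial>\<mu>) =
    (\<integral>V. column_mass i n V * (cmod (V $$ (m, i)))\<^sup>2 \<partial>\<mu>)"
  using assms
proof (induction n)
  case 0
  show ?case by (simp add: column_sum_def column_mass_def)
next
  case (Suc n)
  let ?c = "\<lambda>V. (cmod (V $$ (m, i)))\<^sup>2"
  let ?f = "\<lambda>V. (cmod (column_sum i n V + V $$ (n, i)))\<^sup>2 * ?c V"
  let ?g = "\<lambda>V. (cmod (column_sum i n V - V $$ (n, i)))\<^sup>2 * ?c V"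
  have b: "bounded_rv \<mu> (column_sum i n)" "bounded_rv \<mu> (column_mass i n)"
    "bounded_rv \<mu> (\<lambda>V. V $$ (n, i))" "bounded_rv \<mu> (\<lambda>V. V $$ (m, i))"
    using Suc.prems by (auto intro: column_bounded entry_bounded)
  have fb: "bounded_rv \<mu> ?f" and gb: "bounded_rv \<mu> ?g"
    by (intro bounded_rv_mult bounded_rv_power bounded_rv_norm bounded_rv_add bounded_rv_diff b)+
  have flip: "(\<integral>V. ?f V \<partial>\<mu>) = (\<integral>V. ?g V \<partial>\<mu>)"
    by (rule haar_sign_flip[where m = n])
       (use Suc.prems fb in \<open>auto simp: column_sum_def intro: bounded_rv_measurable\<close>)
  have "(\<integral>V. (cmod (column_sum i (Suc n) V))\<^sup>2 * ?c V \<partial>\<mu>) = (\<integral>V. ?f V \<partial>\<mu>)"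
    by (simp add: column_sum_def)
  also have "\<dots> = ((\<integral>V. ?f V \<partial>\<mu>) + (\<integral>V. ?g V \<partial>\<mu>)) / 2" using flip by simp
  also have "\<dots> = (\<integral>V. (?f V + ?g V) / 2 \<partial>\<mu>)"
    using bounded_rv_integrable[OF fb] bounded_rv_integrable[OF gb] by simp
  also have "\<dots> = (\<integral>V. (cmod (column_sum i n V))\<^sup>2 * ?c V + (cmod (V $$ (n, i)))\<^sup>2 * ?c V \<partial>\<mu>)"
  proof (rule Bochner_Integration.integral_cong[OF refl])
    fix V
    show "(?f V + ?g V) / 2 = (cmod (column_sum i n V))\<^sup>2 * ?c V + (cmod (V $$ (n, i)))\<^sup>2 * ?c V"
      using parallelogram_sq[of "column_sum i n V" "V $$ (n, i)"]
      by (metis (no_types, lifting) distrib_right times_divide_eq_left)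
  qed
  also have "\<dots> = (\<integral>V. (cmod (column_sum i n V))\<^sup>2 * ?c V \<partial>\<mu>) + (\<integral>V. (cmod (V $$ (n, i)))\<^sup>2 * ?c V \<partial>\<mu>)"
    by (intro Bochner_Integration.integral_add bounded_rv_integrable bounded_rv_mult bounded_rv_power bounded_rv_norm b)
  also have "\<dots> = (\<integral>V. column_mass i n V * ?c V \<partial>\<mu>) + (\<integral>V. (cmod (V $$ (n, i)))\<^sup>2 * ?c V \<partial>\<mu>)"
    using Suc by simp
  also have "\<dots> = (\<integral>V. column_mass i n V * ?c V + (cmod (V $$ (n, i)))\<^sup>2 * ?c V \<partial>\<mu>)"
    by (intro Bochner_Integration.integral_add[symmetric] bounded_rv_integrable bounded_rv_mult bounded_rv_power bounded_rv_norm b)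
  also have "\<dots> = (\<integral>V. column_mass i (Suc n) V * ?c V \<partial>\<mu>)"
    by (simp add: column_mass_def distrib_right)
  finally show ?case .
qed

text \<open>
  Khinchine's inequality for the fourth moment, with the random signs supplied by the sign
  invariance of Haar measure; the induction adds one entry at a time.
\<close>
lemma haar_column_sum_fourth_moment_le:
  assumes "n \<le> N"
  shows "(\<integral>V. cmod (column_sum i n V) ^ 4 \<partial>\<mu>) \<le> 3 * (\<integral>V. (column_mass i n V)\<^sup>2 \<partial>\<mu>)"
  using assms
proof (induction n)
  case 0
  show ?case by (simp add: column_sum_def column_mass_def)
next
  case (Suc n)
  let ?S = "column_sum i n" and ?Q = "column_mass i n" and ?c = "\<lambda>V. V $$ (n, i)"
  let ?f = "\<lambda>V. cmod (?S V + ?c V) ^ 4" and ?g = "\<lambda>V. cmod (?S V - ?c V) ^ 4"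
  have b: "bounded_rv \<mu> ?S" "bounded_rv \<mu> ?Q" "bounded_rv \<mu> ?c"
    using Suc.prems by (auto intro: column_bounded entry_bounded)
  have fb: "bounded_rv \<mu> ?f" and gb: "bounded_rv \<mu> ?g"
    by (intro bounded_rv_power bounded_rv_norm bounded_rv_add bounded_rv_diff b)+
  have flip: "(\<integral>V. ?f V \<partial>\<mu>) = (\<integral>V. ?g V \<partial>\<mu>)"
    by (rule haar_sign_flip[where m = n])
       (use Suc.prems fb in \<open>auto simp: column_sum_def intro: bounded_rv_measurable\<close>)
  have "(\<integral>V. cmod (column_sum i (Suc n) V) ^ 4 \<partial>\<mu>) = (\<integral>V. ?f V \<partial>\<mu>)"
    by (simp add: column_sum_def)
  also have "\<dots> = ((\<integral>V. ?f V \<partial>\<mu>) + (\<integral>V. ?g V \<partial>\<mu>)) / 2" using flip by simp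
  also have "\<dots> = (\<integral>V. (?f V + ?g V) / 2 \<partial>\<mu>)"
    using bounded_rv_integrable[OF fb] bounded_rv_integrable[OF gb] by simp
  also have "\<dots> \<le> (\<integral>V. cmod (?S V) ^ 4 + 6 * ((cmod (?S V))\<^sup>2 * (cmod (?c V))\<^sup>2) + cmod (?c V) ^ 4 \<partial>\<mu>)"
  proof (rule integral_mono)
    show "integrable \<mu> (\<lambda>V. (?f V + ?g V) / 2)"
      using bounded_rv_integrable[OF fb] bounded_rv_integrable[OF gb] by simp
    show "integrable \<mu> (\<lambda>V. cmod (?S V) ^ 4 + 6 * ((cmod (?S V))\<^sup>2 * (cmod (?c V))\<^sup>2) + cmod (?c V) ^ 4)"
      by (intro bounded_rv_integrable bounded_rv_add bounded_rv_mult bounded_rv_power bounded_rv_norm bounded_rv_const b)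
  qed (rule parallelogram_fourth_power)
  also have "\<dots> = (\<integral>V. cmod (?S V) ^ 4 \<partial>\<mu>) + 6 * (\<integral>V. (cmod (?S V))\<^sup>2 * (cmod (?c V))\<^sup>2 \<partial>\<mu>) + (\<integral>V. cmod (?c V) ^ 4 \<partial>\<mu>)"
    by (simp add: bounded_rv_integrable bounded_rv_mult bounded_rv_power bounded_rv_norm b)
  also have "\<dots> \<le> 3 * (\<integral>V. (?Q V)\<^sup>2 \<partial>\<mu>) + 6 * (\<integral>V. ?Q V * (cmod (?c V))\<^sup>2 \<partial>\<mu>) + 3 * (\<integral>V. cmod (?c V) ^ 4 \<partial>\<mu>)"
  proof -
    have "0 \<le> (\<integral>V. cmod (?c V) ^ 4 \<partial>\<mu>)" by (rule Bochner_Integration.integral_nonneg) simp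
    then show ?thesis using Suc.IH Suc.prems haar_sum_times_entry[of n n] by linarith
  qed
  also have "\<dots> = (\<integral>V. 3 * (?Q V)\<^sup>2 + 6 * (?Q V * (cmod (?c V))\<^sup>2) + 3 * cmod (?c V) ^ 4 \<partial>\<mu>)"
    by (simp add: bounded_rv_integrable bounded_rv_mult bounded_rv_power bounded_rv_norm b)
  also have "\<dots> = (\<integral>V. 3 * (column_mass i (Suc n) V)\<^sup>2 \<partial>\<mu>)"
    by (rule Bochner_Integration.integral_cong[OF refl])
       (simp add: column_mass_def power2_eq_square power4_eq_xxxx algebra_simps)
  finally show ?case by simp
qed

lemma haar_overlap_bounded:
  assumes "u \<in> carrier_vec N"
  shows "bounded_rv \<mu> (\<lambda>V. overlap V u i)"
proof -
  have "bounded_rv \<mu> (\<lambda>V. \<Sum>k<N. cnj (V $$ (k, i)) * u $ k)"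
    by (intro bounded_rv_sum bounded_rv_mult bounded_rv_cnj bounded_rv_const entry_bounded) simp
  moreover have "(\<Sum>k<N. cnj (V $$ (k, i)) * u $ k) = overlap V u i" if "V \<in> space \<mu>" for V
  proof -
    have "V \<in> carrier_mat N N" using that unitary_groupD(1) by (simp add: haar_space[OF \<mu>])
    then show ?thesis using i assms by (simp add: overlap_def scalar_prod_def atLeast0LessThan)
  qed
  ultimately show ?thesis
    unfolding bounded_rv_def using measurable_cong[of \<mu> "\<lambda>V. \<Sum>k<N. cnj (V $$ (k, i)) * u $ k" "\<lambda>V. overlap V u i" borel]
    by auto
qed

text \<open>
  By invariance \<open>u\<close> may be replaced by the unit vector with equal entries; its overlap with the \<open>i\<close>-th
  column is a column sum divided by \<open>sqrt N\<close>, and the squared entries of a column add up to 1.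
\<close>
lemma haar_overlap_fourth_moment_le:
  assumes u: "u \<in> unit_vectors N"
  shows "(\<integral>V. cmod (overlap V u i) ^ 4 \<partial>\<mu>) \<le> 3 / (real N)\<^sup>2"
proof -
  have N: "0 < N" using i by simp
  define w where "w = Matrix.vec N (\<lambda>_. complex_of_real (1 / sqrt (real N)))"
  have "w \<bullet>c w = of_real (\<Sum>k<N. (1 / sqrt (real N))\<^sup>2)"
    unfolding cscalar_self by (simp add: w_def norm_divide)
  also have "(\<Sum>k<N. (1 / sqrt (real N))\<^sup>2) = 1" using N by (simp add: power_divide)
  finally have w: "w \<in> unit_vectors N" by (simp add: unit_vectors_def w_def)
  obtain W \<phi> where W: "W \<in> unitary_group N" and \<phi>: "cmod \<phi> = 1" "W *\<^sub>v u = \<phi> \<cdot>\<^sub>v w"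
    using unitary_between_unit_vectors[OF u w] by blast
  let ?U = "mat_adjoint W"
  have U: "?U \<in> unitary_group N" by (rule unitary_group_adjoint[OF W])
  have uc: "u \<in> carrier_vec N" using u by (simp add: unit_vectors_def)
  have "(\<integral>V. cmod (overlap V u i) ^ 4 \<partial>\<mu>) = (\<integral>V. cmod (overlap (?U * V) u i) ^ 4 \<partial>\<mu>)"
    by (rule haar_integral_translate[OF \<mu> U, symmetric])
       (intro bounded_rv_measurable bounded_rv_power bounded_rv_norm haar_overlap_bounded uc)
  also have "\<dots> = (\<integral>V. cmod (column_sum i N V) ^ 4 / (real N)\<^sup>2 \<partial>\<mu>)"
  proof (rule Bochner_Integration.integral_cong[OF refl])
    fix V assume "V \<in> space \<mu>"
    then have V: "V \<in> unitary_group N" by (simp add: haar_space[OF \<mu>])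
    note Vc = unitary_groupD(1)[OF V] and Va = unitary_groupD(2)[OF V] and Wc = unitary_groupD(1)[OF W]
    have "mat_adjoint (?U * V) *\<^sub>v u = mat_adjoint V *\<^sub>v (\<phi> \<cdot>\<^sub>v w)"
      unfolding adjoint_mult[OF unitary_groupD(2)[OF W] Vc] mat_adjoint_adjoint
      using assoc_mult_mat_vec[OF Va Wc uc] \<phi>(2) by simp
    then have "overlap (?U * V) u i = (\<Sum>k<N. cnj (V $$ (k, i)) * (\<phi> * of_real (1 / sqrt (real N))))"
      using i Vc by (simp add: overlap_def scalar_prod_def atLeast0LessThan w_def)
    also have "\<dots> = cnj (column_sum i N V) * (\<phi> * of_real (1 / sqrt (real N)))"
      by (simp add: column_sum_def sum_distrib_right sum_divide_distrib)
    finally have "cmod (overlap (?U * V) u i) = cmod (column_sum i N V) * (1 / sqrt (real N))"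
      by (simp add: norm_mult norm_divide \<phi>)
    moreover have "sqrt (real N) ^ 4 = (real N)\<^sup>2"
      by (simp add: power4_eq_xxxx power2_eq_square)
    ultimately show "cmod (overlap (?U * V) u i) ^ 4 = cmod (column_sum i N V) ^ 4 / (real N)\<^sup>2"
      by (simp add: power_mult_distrib power_divide)
  qed
  also have "\<dots> = (\<integral>V. cmod (column_sum i N V) ^ 4 \<partial>\<mu>) / (real N)\<^sup>2" by simp
  also have "\<dots> \<le> 3 * (\<integral>V. (column_mass i N V)\<^sup>2 \<partial>\<mu>) / (real N)\<^sup>2"
    by (intro divide_right_mono haar_column_sum_fourth_moment_le) auto
  also have "(\<integral>V. (column_mass i N V)\<^sup>2 \<partial>\<mu>) = (\<integral>V. 1 \<partial>\<mu>)"
    by (rule Bochner_Integration.integral_cong[OF refl])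
       (simp add: column_mass_def unitary_column_sum_squares i haar_space[OF \<mu>])
  finally show ?thesis by (simp add: prob_space)
qed

end

section \<open>Tilting the law of the eigenvalues\<close>

lemma bounded_rv_compose:
  assumes "bounded_rv (distr M L X) f" "X \<in> measurable M L"
  shows "bounded_rv M (\<lambda>\<omega>. f (X \<omega>))"
proof -
  obtain B where "\<forall>x\<in>space L. norm (f x) \<le> B" using assms(1) by (auto simp: bounded_rv_def)
  then show ?thesis using assms measurable_space[OF assms(2)] measurable_compose[OF assms(2), of f borel]
    by (intro bounded_rvI[where B = B]) (auto simp: bounded_rv_def)
qed

text \<open>
  The random matrix \<open>M\<close> for a single \<open>N\<close>, large enough for the superpolynomial decay of the moments of
  the common law to make them all at most \<open>1/N\<close>.
\<close>
locale haar_diagonal_model = prob_space P for P :: "'w measure" +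
  fixes N :: nat and V :: "'w \<Rightarrow> complex Matrix.mat" and Z :: "nat \<Rightarrow> 'w \<Rightarrow> complex"
  assumes N: "N \<ge> 1"
    and V_meas: "V \<in> measurable P (borel_unitary N)"
    and V_haar: "haar_unitary N (distr P (borel_unitary N) V)"
    and Z_circle: "\<And>i \<omega>. i < N \<Longrightarrow> \<omega> \<in> space P \<Longrightarrow> cmod (Z i \<omega>) = 1"
    and Z_indep: "indep_vars (\<lambda>_. borel) Z {..<N}"
    and Z_ident: "\<And>i. i < N \<Longrightarrow> distr P borel (Z i) = distr P borel (Z 0)"
    and VD_indep: "indep_var (borel_unitary N) V (borel_mat N) (\<lambda>\<omega>. mat_diag N (\<lambda>i. Z i \<omega>))"
    and Z_moment: "\<And>k. k \<ge> 1 \<Longrightarrow> cmod (expectation (\<lambda>\<omega>. Z 0 \<omega> ^ k)) \<le> 1 / real N"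
begin

definition conj_diag :: "'w \<Rightarrow> complex Matrix.mat" where
  "conj_diag \<omega> = V \<omega> * mat_diag N (\<lambda>i. Z i \<omega>) * mat_adjoint (V \<omega>)"

lemma V_unitary: "\<omega> \<in> space P \<Longrightarrow> V \<omega> \<in> unitary_group N"
  using measurable_space[OF V_meas] by simp

lemma Z_meas: "i < N \<Longrightarrow> Z i \<in> borel_measurable P"
  using Z_indep unfolding indep_vars_def by auto

lemma Z_bounded: "i < N \<Longrightarrow> bounded_rv P (Z i)"
  using Z_circle Z_meas by (intro bounded_rvI[where B = 1]) auto

lemma overlap_bounded:
  assumes "i < N" "u \<in> carrier_vec N"
  shows "bounded_rv P (\<lambda>\<omega>. overlap (V \<omega>) u i)"
  by (rule bounded_rv_compose[OF haar_overlap_bounded[OF V_haar assms] V_meas])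

lemma expectation_Z_cong:
  fixes g :: "complex \<Rightarrow> 'b :: {banach, second_countable_topology}"
  assumes "i < N" "g \<in> borel_measurable borel"
  shows "expectation (\<lambda>\<omega>. g (Z i \<omega>)) = expectation (\<lambda>\<omega>. g (Z 0 \<omega>))"
proof -
  have "expectation (\<lambda>\<omega>. g (Z i \<omega>)) = (\<integral>z. g z \<partial>distr P borel (Z i))"
    by (rule integral_distr[symmetric]) (use assms Z_meas in auto)
  also have "\<dots> = expectation (\<lambda>\<omega>. g (Z 0 \<omega>))"
    unfolding Z_ident[OF assms(1)] by (rule integral_distr) (use assms Z_meas N in auto)
  finally show ?thesis .
qed

context
  fixes s :: real
  assumes s: "0 \<le> s" "4 * s\<^sup>2 \<le> real N"
begin

text \<open>
  The density of the tilted law of a single eigenvalue with respect to its original law. Under the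
  uniform law, among the moments of positive order the factor \<open>1 + (s / sqrt N) Re \<zeta>\<^sup>2\<close> shifts that
  of order 2 and leaves the others equal to 0.
\<close>
definition tilt :: "complex \<Rightarrow> real" where
  "tilt \<zeta> = 1 + s / sqrt (real N) * (Re (\<zeta>\<^sup>2) - Re (expectation (\<lambda>\<omega>. Z 0 \<omega> ^ 2)))"

definition likelihood :: "'w \<Rightarrow> real" where
  "likelihood \<omega> = (\<Prod>i<N. tilt (Z i \<omega>))"

lemma s_le: "s / sqrt (real N) \<le> 1 / 2" "s \<le> sqrt (real N) / 2"
proof -
  have "(2 * s)\<^sup>2 \<le> real N" using s by (simp add: power_mult_distrib)
  then have "2 * s \<le> sqrt (real N)" by (rule real_le_rsqrt)
  then show "s \<le> sqrt (real N) / 2" "s / sqrt (real N) \<le> 1 / 2"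
    using N by (auto simp: field_simps)
qed

lemma Z0_bounded: "bounded_rv P (Z 0)" using Z_bounded N by simp

lemma Z0_circle: "\<omega> \<in> space P \<Longrightarrow> cmod (Z 0 \<omega>) = 1" using Z_circle N by simp

lemma cmod_expectation_le_1: "cmod (expectation (\<lambda>\<omega>. Z 0 \<omega> ^ k)) \<le> 1"
proof -
  have "cmod (expectation (\<lambda>\<omega>. Z 0 \<omega> ^ k)) \<le> expectation (\<lambda>\<omega>. cmod (Z 0 \<omega> ^ k))"
    by (rule integral_norm_bound)
  also have "\<dots> = expectation (\<lambda>\<omega>. 1)"
    by (rule Bochner_Integration.integral_cong) (auto simp: norm_power Z0_circle)
  finally show ?thesis by (simp add: prob_space)
qed

lemma tilt_fluctuation_le:
  assumes "cmod \<zeta> = 1"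
  shows "\<bar>Re (\<zeta>\<^sup>2) - Re (expectation (\<lambda>\<omega>. Z 0 \<omega> ^ 2))\<bar> \<le> 2"
proof -
  have "\<bar>Re (\<zeta>\<^sup>2)\<bar> \<le> 1" using abs_Re_le_cmod[of "\<zeta>\<^sup>2"] assms by (simp add: norm_power)
  moreover have "\<bar>Re (expectation (\<lambda>\<omega>. Z 0 \<omega> ^ 2))\<bar> \<le> 1"
    using abs_Re_le_cmod cmod_expectation_le_1 order.trans by blast
  ultimately show ?thesis by linarith
qed

lemma tilt_nonneg:
  assumes "cmod \<zeta> = 1"
  shows "0 \<le> tilt \<zeta>"
proof -
  have "\<bar>s / sqrt (real N) * (Re (\<zeta>\<^sup>2) - Re (expectation (\<lambda>\<omega>. Z 0 \<omega> ^ 2)))\<bar> \<le> 1 / 2 * 2"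
    unfolding abs_mult using tilt_fluctuation_le[OF assms] s_le s by (intro mult_mono) auto
  then show ?thesis unfolding tilt_def by linarith
qed

lemma tilt_meas: "tilt \<in> borel_measurable borel"
  unfolding tilt_def[abs_def] by measurable

lemma tilt_bounded: "i < N \<Longrightarrow> bounded_rv P (\<lambda>\<omega>. tilt (Z i \<omega>))"
  unfolding tilt_def
  by (intro bounded_rv_add bounded_rv_mult bounded_rv_diff bounded_rv_const bounded_rv_Re bounded_rv_power Z_bounded)

lemma Re_expectation: "bounded_rv P f \<Longrightarrow> Re (expectation f) = expectation (\<lambda>\<omega>. Re (f \<omega>))"
  by (rule integral_Re[symmetric]) (rule bounded_rv_integrable)

lemma expectation_tilt: "expectation (\<lambda>\<omega>. tilt (Z 0 \<omega>)) = 1"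
proof -
  have b: "bounded_rv P (\<lambda>\<omega>. (Z 0 \<omega>)\<^sup>2)" by (intro bounded_rv_power Z0_bounded)
  note bounded_rv_integrable[OF bounded_rv_Re[OF b]]
  then show ?thesis unfolding tilt_def by (simp add: prob_space Re_expectation[OF b])
qed

lemma expectation_tilt_sq: "expectation (\<lambda>\<omega>. (tilt (Z 0 \<omega>))\<^sup>2) \<le> 1 + 4 * s\<^sup>2 / real N"
proof -
  have b: "bounded_rv P (\<lambda>\<omega>. tilt (Z 0 \<omega>))" using tilt_bounded N by simp
  have "expectation (\<lambda>\<omega>. (tilt (Z 0 \<omega>))\<^sup>2) = expectation (\<lambda>\<omega>. (2 * tilt (Z 0 \<omega>) - 1) + (tilt (Z 0 \<omega>) - 1)\<^sup>2)"
    by (rule Bochner_Integration.integral_cong) (simp_all add: power2_eq_square algebra_simps)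
  also have "\<dots> = expectation (\<lambda>\<omega>. 2 * tilt (Z 0 \<omega>) - 1) + expectation (\<lambda>\<omega>. (tilt (Z 0 \<omega>) - 1)\<^sup>2)"
    by (intro Bochner_Integration.integral_add bounded_rv_integrable bounded_rv_diff bounded_rv_mult bounded_rv_power bounded_rv_const b)
  also have "expectation (\<lambda>\<omega>. 2 * tilt (Z 0 \<omega>) - 1) = 1"
    using bounded_rv_integrable[OF b] by (simp add: expectation_tilt prob_space)
  also have "expectation (\<lambda>\<omega>. (tilt (Z 0 \<omega>) - 1)\<^sup>2) \<le> expectation (\<lambda>\<omega>. 4 * s\<^sup>2 / real N)"
  proof (rule integral_mono)
    fix \<omega> assume "\<omega> \<in> space P"
    from tilt_fluctuation_le[OF Z0_circle[OF this]]
    have "(Re ((Z 0 \<omega>)\<^sup>2) - Re (expectation (\<lambda>\<omega>. Z 0 \<omega> ^ 2)))\<^sup>2 \<le> 2\<^sup>2"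
      using abs_le_square_iff by fastforce
    then have "s\<^sup>2 / real N * (Re ((Z 0 \<omega>)\<^sup>2) - Re (expectation (\<lambda>\<omega>. Z 0 \<omega> ^ 2)))\<^sup>2 \<le> s\<^sup>2 / real N * 2\<^sup>2"
      by (intro mult_left_mono) auto
    then show "(tilt (Z 0 \<omega>) - 1)\<^sup>2 \<le> 4 * s\<^sup>2 / real N"
      by (simp add: tilt_def power_mult_distrib power_divide mult.commute)
  qed (auto intro!: bounded_rv_integrable bounded_rv_power bounded_rv_diff b)
  finally show ?thesis by (simp add: prob_space)
qed

lemma expectation_prod_Z:
  fixes g :: "nat \<Rightarrow> complex \<Rightarrow> 'b :: {real_normed_field, banach, second_countable_topology}"
  assumes "\<And>i. i < N \<Longrightarrow> g i \<in> borel_measurable borel" "\<And>i. i < N \<Longrightarrow> bounded_rv P (\<lambda>\<omega>. g i (Z i \<omega>))"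
  shows "expectation (\<lambda>\<omega>. \<Prod>i<N. g i (Z i \<omega>)) = (\<Prod>i<N. expectation (\<lambda>\<omega>. g i (Z 0 \<omega>)))"
proof -
  have "expectation (\<lambda>\<omega>. \<Prod>i<N. g i (Z i \<omega>)) = (\<Prod>i<N. expectation (\<lambda>\<omega>. g i (Z i \<omega>)))"
  proof (rule indep_vars_lebesgue_integral)
    show "indep_vars (\<lambda>_. borel) (\<lambda>i \<omega>. g i (Z i \<omega>)) {..<N}"
      by (rule indep_vars_compose2[OF Z_indep]) (simp add: assms(1))
    show "integrable P (\<lambda>\<omega>. g i (Z i \<omega>))" if "i \<in> {..<N}" for i
      using assms(2) that by (intro bounded_rv_integrable) simp
  qed simp
  also have "\<dots> = (\<Prod>i<N. expectation (\<lambda>\<omega>. g i (Z 0 \<omega>)))"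
    by (intro prod.cong refl expectation_Z_cong assms(1)) auto
  finally show ?thesis .
qed

lemma likelihood_nonneg: "\<omega> \<in> space P \<Longrightarrow> 0 \<le> likelihood \<omega>"
  unfolding likelihood_def by (intro prod_nonneg) (auto intro: tilt_nonneg Z_circle)

lemma likelihood_bounded: "bounded_rv P likelihood"
  unfolding likelihood_def[abs_def] by (intro bounded_rv_prod tilt_bounded) simp

lemma expectation_likelihood: "expectation likelihood = 1"
  unfolding likelihood_def[abs_def]
  by (subst expectation_prod_Z) (auto simp: tilt_meas tilt_bounded expectation_tilt)

text \<open>
  A tilt of size \<open>1 / sqrt N\<close> in each of \<open>N\<close> independent factors changes the second moment of the likelihood
  ratio by a bounded factor only. This is what makes the tilted events non-negligible.
\<close>
lemma expectation_likelihood_sq: "expectation (\<lambda>\<omega>. (likelihood \<omega>)\<^sup>2) \<le> exp (4 * s\<^sup>2)"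
proof -
  have "expectation (\<lambda>\<omega>. (likelihood \<omega>)\<^sup>2) = expectation (\<lambda>\<omega>. \<Prod>i<N. (tilt (Z i \<omega>))\<^sup>2)"
    by (simp add: likelihood_def prod_power_distrib)
  also have "\<dots> = (\<Prod>i<N. expectation (\<lambda>\<omega>. (tilt (Z 0 \<omega>))\<^sup>2))"
    by (rule expectation_prod_Z) (auto intro!: borel_measurable_power tilt_meas bounded_rv_power tilt_bounded)
  also have "\<dots> \<le> (\<Prod>i<N. exp (4 * s\<^sup>2 / real N))"
  proof (rule prod_mono)
    have "expectation (\<lambda>\<omega>. (tilt (Z 0 \<omega>))\<^sup>2) \<le> exp (4 * s\<^sup>2 / real N)"
      by (rule order.trans[OF expectation_tilt_sq exp_ge_add_one_self])
    then show "0 \<le> expectation (\<lambda>\<omega>. (tilt (Z 0 \<omega>))\<^sup>2) \<and> expectation (\<lambda>\<omega>. (tilt (Z 0 \<omega>))\<^sup>2) \<le> exp (4 * s\<^sup>2 / real N)" for i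
      by (simp add: Bochner_Integration.integral_nonneg)
  qed
  also have "\<dots> = exp (4 * s\<^sup>2)" using N by (simp flip: exp_of_nat_mult)
  finally show ?thesis .
qed

definition tilted_moment :: "nat \<Rightarrow> complex" where
  "tilted_moment k = expectation (\<lambda>\<omega>. of_real (tilt (Z 0 \<omega>)) * Z 0 \<omega> ^ k)"

lemma tilted_moment_le_1: "cmod (tilted_moment k) \<le> 1"
proof -
  have "cmod (tilted_moment k) \<le> expectation (\<lambda>\<omega>. cmod (of_real (tilt (Z 0 \<omega>)) * Z 0 \<omega> ^ k))"
    unfolding tilted_moment_def by (rule integral_norm_bound)
  also have "\<dots> = expectation (\<lambda>\<omega>. tilt (Z 0 \<omega>))"
    by (rule Bochner_Integration.integral_cong)
       (simp_all add: norm_mult norm_power Z0_circle tilt_nonneg)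
  finally show ?thesis by (simp add: expectation_tilt)
qed

text \<open>
  On the circle \<open>cnj \<zeta>\<^sup>2 \<zeta>\<^sup>k\<close> is \<open>\<zeta>\<^bsup>k-2\<^esup>\<close>, or \<open>cnj \<zeta>\<close> if \<open>k = 1\<close>, so its mean is a moment of the law.
\<close>
lemma expectation_mixed_moment:
  assumes "k \<ge> 1"
  shows "cmod (expectation (\<lambda>\<omega>. cnj (Z 0 \<omega>) ^ 2 * Z 0 \<omega> ^ k) - (if k = 2 then 1 else 0)) \<le> 1 / real N"
proof -
  have unit: "cnj (Z 0 \<omega>) * Z 0 \<omega> = 1" if "\<omega> \<in> space P" for \<omega>
    using Z0_circle[OF that] by (metis complex_norm_square mult.commute of_real_1 one_power2)
  consider "k = 1" | "k = 2" | "k \<ge> 3" using assms by linarith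
  then show ?thesis
  proof cases
    case 1
    have "expectation (\<lambda>\<omega>. cnj (Z 0 \<omega>) ^ 2 * Z 0 \<omega> ^ k) = expectation (\<lambda>\<omega>. cnj (Z 0 \<omega> ^ 1))"
      by (rule Bochner_Integration.integral_cong) (use unit 1 in \<open>simp_all add: power2_eq_square mult.assoc\<close>)
    also have "\<dots> = cnj (expectation (\<lambda>\<omega>. Z 0 \<omega> ^ 1))"
      using bounded_rv_integrable[OF Z0_bounded] by simp
    finally show ?thesis using Z_moment[of 1] 1 by simp
  next
    case 2
    have "expectation (\<lambda>\<omega>. cnj (Z 0 \<omega>) ^ 2 * Z 0 \<omega> ^ k) = expectation (\<lambda>\<omega>. 1)"
      by (rule Bochner_Integration.integral_cong) (use unit 2 in \<open>simp_all flip: power_mult_distrib\<close>)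
    then show ?thesis using 2 by (simp add: prob_space)
  next
    case 3
    define j where "j = k - 2"
    have j: "k = j + 2" "j \<ge> 1" using 3 by (auto simp: j_def)
    have "expectation (\<lambda>\<omega>. cnj (Z 0 \<omega>) ^ 2 * Z 0 \<omega> ^ k) = expectation (\<lambda>\<omega>. Z 0 \<omega> ^ j)"
    proof (rule Bochner_Integration.integral_cong[OF refl])
      fix \<omega> assume "\<omega> \<in> space P"
      have "cnj (Z 0 \<omega>) ^ 2 * Z 0 \<omega> ^ k = (cnj (Z 0 \<omega>) * Z 0 \<omega>) ^ 2 * Z 0 \<omega> ^ j"
        by (simp only: j power_add power_mult_distrib mult_ac)
      then show "cnj (Z 0 \<omega>) ^ 2 * Z 0 \<omega> ^ k = Z 0 \<omega> ^ j"
        using unit[OF \<open>\<omega> \<in> space P\<close>] by simp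
    qed
    then show ?thesis using Z_moment[of j] 3 j by simp
  qed
qed

text \<open>
  Expanding \<open>Re \<zeta>\<^sup>2 = (\<zeta>\<^sup>2 + cnj \<zeta>\<^sup>2)/2\<close> in the tilt, every term is a moment of positive order, and hence
  small, except for the constant produced by \<open>k = 2\<close>.
\<close>
lemma tilted_moment_approx:
  assumes k: "k \<ge> 1"
  shows "cmod (of_real (sqrt (real N)) * tilted_moment k - (if k = 2 then of_real (s / 2) else 0)) \<le> 2"
proof -
  let ?e = "\<lambda>k. expectation (\<lambda>\<omega>. Z 0 \<omega> ^ k)"
  let ?f = "expectation (\<lambda>\<omega>. cnj (Z 0 \<omega>) ^ 2 * Z 0 \<omega> ^ k)"
  let ?m = "complex_of_real (Re (?e 2))"
  let ?q = "complex_of_real (sqrt (real N))"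
  let ?d = "if k = 2 then 1 else 0 :: complex"
  have q: "?q \<noteq> 0" using N by simp
  have ints: "integrable P (\<lambda>\<omega>. Z 0 \<omega> ^ k)" "integrable P (\<lambda>\<omega>. Z 0 \<omega> ^ (k + 2))"
    "integrable P (\<lambda>\<omega>. cnj (Z 0 \<omega>) ^ 2 * Z 0 \<omega> ^ k)"
    by (intro bounded_rv_integrable bounded_rv_mult bounded_rv_power bounded_rv_cnj Z0_bounded)+
  have "of_real (tilt \<zeta>) * \<zeta> ^ k = (1 - of_real s / ?q * ?m) * \<zeta> ^ k +
      of_real s / ?q / 2 * \<zeta> ^ (k + 2) + of_real s / ?q / 2 * (cnj \<zeta> ^ 2 * \<zeta> ^ k)" for \<zeta>
  proof -
    have "complex_of_real (Re (\<zeta>\<^sup>2)) = (\<zeta>\<^sup>2 + cnj \<zeta> ^ 2) / 2"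
      using complex_add_cnj[of "\<zeta>\<^sup>2"] by simp
    then show ?thesis by (simp add: tilt_def power_add power2_eq_square algebra_simps add_divide_distrib)
  qed
  then have "tilted_moment k = expectation (\<lambda>\<omega>. (1 - of_real s / ?q * ?m) * Z 0 \<omega> ^ k +
      of_real s / ?q / 2 * Z 0 \<omega> ^ (k + 2) + of_real s / ?q / 2 * (cnj (Z 0 \<omega>) ^ 2 * Z 0 \<omega> ^ k))"
    by (simp add: tilted_moment_def)
  also have "\<dots> = (1 - of_real s / ?q * ?m) * ?e k + of_real s / ?q / 2 * ?e (k + 2) + of_real s / ?q / 2 * ?f"
    using ints by simp
  finally have expand: "tilted_moment k =
      (1 - of_real s / ?q * ?m) * ?e k + of_real s / ?q / 2 * ?e (k + 2) + of_real s / ?q / 2 * ?f" .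
  have rearrange: "q * T - S / 2 * d = q * E + S * (E' / 2 + (F - d) / 2 - m * E)"
    if "T = (1 - S / q * m) * E + S / q / 2 * E' + S / q / 2 * F" "q \<noteq> 0" for q T S d E E' F m :: complex
    unfolding that(1) using that(2) by (simp add: field_simps)
  have "(if k = 2 then of_real (s / 2) else 0) = of_real s / 2 * ?d" by simp
  then have "?q * tilted_moment k - (if k = 2 then of_real (s / 2) else 0) =
      ?q * ?e k + of_real s * (?e (k + 2) / 2 + (?f - ?d) / 2 - ?m * ?e k)"
    using rearrange[OF expand q, of ?d] by (simp only:)
  also have "cmod \<dots> \<le> sqrt (real N) * (1 / real N) + s * (2 / real N)"
  proof (rule order.trans[OF norm_triangle_ineq] add_mono)+
    show "cmod (?q * ?e k) \<le> sqrt (real N) * (1 / real N)"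
      unfolding norm_mult using Z_moment[OF k] by (intro mult_mono) auto
    have "cmod (?m * ?e k) \<le> 1 * (1 / real N)"
      unfolding norm_mult norm_of_real
      using Z_moment[OF k] abs_Re_le_cmod[of "?e 2"] cmod_expectation_le_1[of 2] by (intro mult_mono) auto
    moreover have "cmod (?e (k + 2) / 2) \<le> 1 / real N / 2" using Z_moment[of "k + 2"] by (simp add: norm_divide)
    moreover have "cmod ((?f - ?d) / 2) \<le> 1 / real N / 2"
      using expectation_mixed_moment[OF k] by (simp add: norm_divide)
    ultimately have "cmod (?e (k + 2) / 2 + (?f - ?d) / 2 - ?m * ?e k) \<le> 2 / real N"
      using norm_triangle_ineq4[of "?e (k + 2) / 2 + (?f - ?d) / 2" "?m * ?e k"]
        norm_triangle_ineq[of "?e (k + 2) / 2" "(?f - ?d) / 2"] by (simp add: field_simps)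
    then show "cmod (of_real s * (?e (k + 2) / 2 + (?f - ?d) / 2 - ?m * ?e k)) \<le> s * (2 / real N)"
      unfolding norm_mult using s by (intro mult_mono) auto
  qed
  also have "\<dots> \<le> sqrt (real N) * (1 / real N) + sqrt (real N) / 2 * (2 / real N)"
    using s_le(2) by (intro add_left_mono mult_right_mono) auto
  also have "\<dots> = 2 / sqrt (real N)"
    using N by (simp add: field_simps)
  also have "\<dots> \<le> 2" using N by (simp add: field_simps)
  finally show ?thesis .
qed

lemma moment_conj_diag_model:
  assumes "u \<in> carrier_vec N" "\<omega> \<in> space P"
  shows "moment (conj_diag \<omega>) u k = (\<Sum>i<N. of_real ((cmod (overlap (V \<omega>) u i))\<^sup>2) * Z i \<omega> ^ k)"
  unfolding conj_diag_def by (rule moment_conj_diag[OF V_unitary[OF assms(2)] assms(1)])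

text \<open>
  Under the tilted probability the eigenvalues are still independent and identically distributed, so
  that centred variables with different indices are uncorrelated.
\<close>
lemma expectation_likelihood_centered:
  assumes ij: "i < N" "j < N"
  shows "expectation (\<lambda>\<omega>. of_real (likelihood \<omega>) * (Z i \<omega> ^ k - tilted_moment k) * cnj (Z j \<omega> ^ k - tilted_moment k)) =
    (if i = j then expectation (\<lambda>\<omega>. of_real (tilt (Z 0 \<omega>)) * (Z 0 \<omega> ^ k - tilted_moment k) * cnj (Z 0 \<omega> ^ k - tilted_moment k)) else 0)"
proof -
  let ?\<xi> = "\<lambda>\<zeta>. \<zeta> ^ k - tilted_moment k"
  let ?g = "\<lambda>l \<zeta>. of_real (tilt \<zeta>) * (if l = i then ?\<xi> \<zeta> else 1) * (if l = j then cnj (?\<xi> \<zeta>) else 1)"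
  have "of_real (likelihood \<omega>) * ?\<xi> (Z i \<omega>) * cnj (?\<xi> (Z j \<omega>)) = (\<Prod>l<N. ?g l (Z l \<omega>))" for \<omega>
    using ij by (simp add: likelihood_def prod.distrib)
  then have "expectation (\<lambda>\<omega>. of_real (likelihood \<omega>) * ?\<xi> (Z i \<omega>) * cnj (?\<xi> (Z j \<omega>))) =
      expectation (\<lambda>\<omega>. \<Prod>l<N. ?g l (Z l \<omega>))" by simp
  also have "\<dots> = (\<Prod>l<N. expectation (\<lambda>\<omega>. ?g l (Z 0 \<omega>)))"
  proof (rule expectation_prod_Z)
    fix l assume l: "l < N"
    have [measurable]: "tilt \<in> borel_measurable borel" by (rule tilt_meas)
    have [measurable]: "cnj \<in> borel_measurable borel"
      by (intro borel_measurable_continuous_onI continuous_intros)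
    show "?g l \<in> borel_measurable borel" by measurable
    have "bounded_rv P (\<lambda>\<omega>. if l = i then ?\<xi> (Z l \<omega>) else 1)"
      using bounded_rv_diff[OF bounded_rv_power[OF Z_bounded[OF l]] bounded_rv_const]
      by (cases "l = i") simp_all
    moreover have "bounded_rv P (\<lambda>\<omega>. if l = j then cnj (?\<xi> (Z l \<omega>)) else 1)"
      using bounded_rv_cnj[OF bounded_rv_diff[OF bounded_rv_power[OF Z_bounded[OF l]] bounded_rv_const]]
      by (cases "l = j") simp_all
    ultimately show "bounded_rv P (\<lambda>\<omega>. ?g l (Z l \<omega>))"
      by (intro bounded_rv_mult bounded_rv_of_real tilt_bounded l)
  qed
  also have "\<dots> = (if i = j then expectation (\<lambda>\<omega>. of_real (tilt (Z 0 \<omega>)) * ?\<xi> (Z 0 \<omega>) * cnj (?\<xi> (Z 0 \<omega>))) else 0)"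
  proof (cases "i = j")
    case True
    have "expectation (\<lambda>\<omega>. complex_of_real (tilt (Z 0 \<omega>))) = 1" by (simp add: expectation_tilt)
    then have "(\<Prod>l\<in>{..<N} - {i}. expectation (\<lambda>\<omega>. ?g l (Z 0 \<omega>))) = 1"
      using True by (intro prod.neutral) auto
    then show ?thesis using prod.remove[of "{..<N}" i "\<lambda>l. expectation (\<lambda>\<omega>. ?g l (Z 0 \<omega>))"] ij True by simp
  next
    case False
    have b: "bounded_rv P (\<lambda>\<omega>. complex_of_real (tilt (Z 0 \<omega>)))"
      using tilt_bounded N by (intro bounded_rv_of_real) simp
    have "expectation (\<lambda>\<omega>. ?g i (Z 0 \<omega>)) =
        expectation (\<lambda>\<omega>. of_real (tilt (Z 0 \<omega>)) * Z 0 \<omega> ^ k - of_real (tilt (Z 0 \<omega>)) * tilted_moment k)"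
      using False by (simp add: right_diff_distrib)
    also have "\<dots> = tilted_moment k - expectation (\<lambda>\<omega>. of_real (tilt (Z 0 \<omega>)) * tilted_moment k)"
      unfolding tilted_moment_def[symmetric]
      by (subst Bochner_Integration.integral_diff)
         (auto simp: tilted_moment_def intro!: bounded_rv_integrable bounded_rv_mult bounded_rv_power b Z0_bounded)
    also have "\<dots> = 0" using expectation_tilt by simp
    finally have "expectation (\<lambda>\<omega>. ?g i (Z 0 \<omega>)) = 0" .
    then have "(\<Prod>l<N. expectation (\<lambda>\<omega>. ?g l (Z 0 \<omega>))) = 0"
      using ij by (intro prod_zero bexI[where x = i]) (assumption | simp only: finite_lessThan lessThan_iff)+
    then show ?thesis unfolding if_not_P[OF False] .
  qed
  finally show ?thesis .
qed

lemma tilted_variance_le: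
  "cmod (expectation (\<lambda>\<omega>. of_real (tilt (Z 0 \<omega>)) * (Z 0 \<omega> ^ k - tilted_moment k) * cnj (Z 0 \<omega> ^ k - tilted_moment k))) \<le> 4"
proof -
  let ?\<xi> = "\<lambda>\<omega>. Z 0 \<omega> ^ k - tilted_moment k"
  have b: "bounded_rv P (\<lambda>\<omega>. tilt (Z 0 \<omega>))" using tilt_bounded N by simp
  have "cmod (expectation (\<lambda>\<omega>. of_real (tilt (Z 0 \<omega>)) * ?\<xi> \<omega> * cnj (?\<xi> \<omega>))) \<le>
      expectation (\<lambda>\<omega>. cmod (of_real (tilt (Z 0 \<omega>)) * ?\<xi> \<omega> * cnj (?\<xi> \<omega>)))"
    by (rule integral_norm_bound)
  also have "\<dots> \<le> expectation (\<lambda>\<omega>. tilt (Z 0 \<omega>) * 4)"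
  proof (rule integral_mono)
    show "integrable P (\<lambda>\<omega>. cmod (of_real (tilt (Z 0 \<omega>)) * ?\<xi> \<omega> * cnj (?\<xi> \<omega>)))"
      by (intro bounded_rv_integrable bounded_rv_norm bounded_rv_mult bounded_rv_of_real bounded_rv_cnj
          bounded_rv_diff bounded_rv_power bounded_rv_const Z0_bounded b)
    show "integrable P (\<lambda>\<omega>. tilt (Z 0 \<omega>) * 4)"
      by (intro bounded_rv_integrable bounded_rv_mult bounded_rv_const b)
    fix \<omega> assume \<omega>: "\<omega> \<in> space P"
    have "cmod (?\<xi> \<omega>) \<le> 1 + 1"
      by (rule order.trans[OF norm_triangle_ineq4], rule add_mono)
         (simp_all add: norm_power Z0_circle[OF \<omega>] tilted_moment_le_1)
    then have "cmod (?\<xi> \<omega>) * cmod (?\<xi> \<omega>) \<le> 2 * 2" by (intro mult_mono) auto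
    then have "tilt (Z 0 \<omega>) * (cmod (?\<xi> \<omega>) * cmod (?\<xi> \<omega>)) \<le> tilt (Z 0 \<omega>) * 4"
      using tilt_nonneg[OF Z0_circle[OF \<omega>]] by (intro mult_left_mono) auto
    then show "cmod (of_real (tilt (Z 0 \<omega>)) * ?\<xi> \<omega> * cnj (?\<xi> \<omega>)) \<le> tilt (Z 0 \<omega>) * 4"
      unfolding norm_mult complex_mod_cnj norm_of_real
      using tilt_nonneg[OF Z0_circle[OF \<omega>]] by (simp add: mult.assoc)
  qed
  also have "\<dots> = 4" by (simp add: expectation_tilt)
  finally show ?thesis .
qed

lemma expectation_overlap_times_likelihood:
  assumes u: "u \<in> carrier_vec N" and ij: "i < N" "j < N"
  shows "expectation (\<lambda>\<omega>. of_real ((cmod (overlap (V \<omega>) u i))\<^sup>2 * (cmod (overlap (V \<omega>) u j))\<^sup>2) *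
      (of_real (likelihood \<omega>) * (Z i \<omega> ^ k - tilted_moment k) * cnj (Z j \<omega> ^ k - tilted_moment k))) =
    expectation (\<lambda>\<omega>. complex_of_real ((cmod (overlap (V \<omega>) u i))\<^sup>2 * (cmod (overlap (V \<omega>) u j))\<^sup>2)) *
    expectation (\<lambda>\<omega>. of_real (likelihood \<omega>) * (Z i \<omega> ^ k - tilted_moment k) * cnj (Z j \<omega> ^ k - tilted_moment k))"
proof (rule indep_var_lebesgue_integral)
  let ?\<mu> = "distr P (borel_unitary N) V"
  let ?f = "\<lambda>W. complex_of_real ((cmod (overlap W u i))\<^sup>2 * (cmod (overlap W u j))\<^sup>2)"
  let ?g = "\<lambda>A. of_real (\<Prod>l<N. tilt (A $$ (l, l))) * (A $$ (i, i) ^ k - tilted_moment k) *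
    cnj (A $$ (j, j) ^ k - tilted_moment k)"
  have f: "bounded_rv ?\<mu> ?f"
    by (intro bounded_rv_of_real bounded_rv_mult bounded_rv_power bounded_rv_norm haar_overlap_bounded[OF V_haar] ij u)
  then have "?f \<in> borel_measurable (borel_unitary N)" by (auto dest: bounded_rv_measurable)
  moreover have "?g \<in> borel_measurable (borel_mat N)"
  proof -
    have [measurable]: "tilt \<in> borel_measurable borel" by (rule tilt_meas)
    have [measurable]: "cnj \<in> borel_measurable borel"
      by (intro borel_measurable_continuous_onI continuous_intros)
    have [measurable]: "(\<lambda>A. A $$ (l, l)) \<in> borel_measurable (borel_mat N)" if "l \<in> {..<N}" for l
      using that by (intro borel_mat_entry) auto
    have [measurable]: "(\<lambda>A. A $$ (i, i)) \<in> borel_measurable (borel_mat N)"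
      "(\<lambda>A. A $$ (j, j)) \<in> borel_measurable (borel_mat N)"
      using ij by (auto intro!: borel_mat_entry)
    show ?thesis by measurable
  qed
  ultimately have "indep_var borel (?f \<circ> V) borel (?g \<circ> (\<lambda>\<omega>. mat_diag N (\<lambda>i. Z i \<omega>)))"
    by (rule indep_var_compose[OF VD_indep])
  moreover have "?g \<circ> (\<lambda>\<omega>. mat_diag N (\<lambda>i. Z i \<omega>)) =
     (\<lambda>\<omega>. of_real (likelihood \<omega>) * (Z i \<omega> ^ k - tilted_moment k) * cnj (Z j \<omega> ^ k - tilted_moment k))"
    using ij by (simp add: comp_def likelihood_def mat_diag_def)
  ultimately show "indep_var borel (\<lambda>\<omega>. ?f (V \<omega>)) borel
     (\<lambda>\<omega>. of_real (likelihood \<omega>) * (Z i \<omega> ^ k - tilted_moment k) * cnj (Z j \<omega> ^ k - tilted_moment k))"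
    by (simp add: comp_def)
  show "integrable P (\<lambda>\<omega>. ?f (V \<omega>))"
    by (rule bounded_rv_integrable[OF bounded_rv_compose[OF f V_meas]])
  show "integrable P (\<lambda>\<omega>. of_real (likelihood \<omega>) * (Z i \<omega> ^ k - tilted_moment k) * cnj (Z j \<omega> ^ k - tilted_moment k))"
    by (intro bounded_rv_integrable bounded_rv_mult bounded_rv_of_real bounded_rv_cnj
          bounded_rv_diff bounded_rv_power bounded_rv_const Z_bounded likelihood_bounded ij)
qed

lemma expectation_overlap_fourth_le:
  assumes "u \<in> unit_vectors N" "i < N"
  shows "expectation (\<lambda>\<omega>. cmod (overlap (V \<omega>) u i) ^ 4) \<le> 3 / (real N)\<^sup>2"
proof -
  have "u \<in> carrier_vec N" using assms by (simp add: unit_vectors_def)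
  from bounded_rv_measurable[OF bounded_rv_power[OF bounded_rv_norm[OF haar_overlap_bounded[OF V_haar assms(2) this]], of 4]]
  have "(\<integral>W. cmod (overlap W u i) ^ 4 \<partial>distr P (borel_unitary N) V) = expectation (\<lambda>\<omega>. cmod (overlap (V \<omega>) u i) ^ 4)"
    by (intro integral_distr V_meas) simp
  then show ?thesis using haar_overlap_fourth_moment_le[OF V_haar assms(2,1)] by simp
qed

lemma moment_bounded:
  assumes u: "u \<in> carrier_vec N"
  shows "bounded_rv P (\<lambda>\<omega>. moment (conj_diag \<omega>) u k)"
proof -
  have b: "bounded_rv P (\<lambda>\<omega>. \<Sum>i<N. of_real ((cmod (overlap (V \<omega>) u i))\<^sup>2) * Z i \<omega> ^ k)"
    by (intro bounded_rv_sum bounded_rv_mult bounded_rv_of_real bounded_rv_power bounded_rv_norm overlap_bounded Z_bounded u) auto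
  moreover have "moment (conj_diag \<omega>) u k = (\<Sum>i<N. of_real ((cmod (overlap (V \<omega>) u i))\<^sup>2) * Z i \<omega> ^ k)" if "\<omega> \<in> space P" for \<omega>
    by (rule moment_conj_diag_model[OF u that])
  ultimately show ?thesis
    unfolding bounded_rv_def
    using measurable_cong[of P "\<lambda>\<omega>. \<Sum>i<N. of_real ((cmod (overlap (V \<omega>) u i))\<^sup>2) * Z i \<omega> ^ k" "\<lambda>\<omega>. moment (conj_diag \<omega>) u k" borel]
    by auto
qed

text \<open>
  The moment is an average of independent variables with the weights \<open>p\<^sub>i\<close>, which do not depend on
  the eigenvalues, so its variance is at most a constant times \<open>E \<Sum>\<^sub>i p\<^sub>i\<^sup>2\<close>.
\<close>
lemma tilted_second_moment_le:
  assumes u: "u \<in> unit_vectors N"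
  shows "expectation (\<lambda>\<omega>. likelihood \<omega> * (cmod (moment (conj_diag \<omega>) u k - tilted_moment k))\<^sup>2) \<le> 12 / real N"
proof -
  have uc: "u \<in> carrier_vec N" using u by (simp add: unit_vectors_def)
  let ?p = "\<lambda>i \<omega>. (cmod (overlap (V \<omega>) u i))\<^sup>2"
  let ?\<xi> = "\<lambda>i \<omega>. Z i \<omega> ^ k - tilted_moment k"
  let ?c = "expectation (\<lambda>\<omega>. of_real (tilt (Z 0 \<omega>)) * ?\<xi> 0 \<omega> * cnj (?\<xi> 0 \<omega>))"
  let ?h = "\<lambda>i j \<omega>. complex_of_real (?p i \<omega> * ?p j \<omega>) * (of_real (likelihood \<omega>) * ?\<xi> i \<omega> * cnj (?\<xi> j \<omega>))"
  let ?E = "expectation (\<lambda>\<omega>. likelihood \<omega> * (cmod (moment (conj_diag \<omega>) u k - tilted_moment k))\<^sup>2)"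
  have expand: "complex_of_real (likelihood \<omega> * (cmod (moment (conj_diag \<omega>) u k - tilted_moment k))\<^sup>2) =
      (\<Sum>i<N. \<Sum>j<N. ?h i j \<omega>)" if \<omega>: "\<omega> \<in> space P" for \<omega>
  proof -
    have "(\<Sum>i<N. complex_of_real (?p i \<omega>)) = 1"
      using overlap_sum_squares[OF V_unitary[OF \<omega>] u] by (metis of_real_1 of_real_sum)
    then have "moment (conj_diag \<omega>) u k - tilted_moment k = (\<Sum>i<N. of_real (?p i \<omega>) * ?\<xi> i \<omega>)"
      unfolding moment_conj_diag_model[OF uc \<omega>]
      by (simp add: right_diff_distrib sum_subtractf flip: sum_distrib_right)
    then have "complex_of_real (likelihood \<omega> * (cmod (moment (conj_diag \<omega>) u k - tilted_moment k))\<^sup>2) =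
       of_real (likelihood \<omega>) * ((\<Sum>i<N. of_real (?p i \<omega>) * ?\<xi> i \<omega>) * cnj (\<Sum>i<N. of_real (?p i \<omega>) * ?\<xi> i \<omega>))"
      unfolding of_real_mult complex_norm_square by simp
    also have "\<dots> = (\<Sum>i<N. \<Sum>j<N. ?h i j \<omega>)"
      unfolding cnj_sum unfolding sum_product unfolding sum_distrib_left
      by (intro sum.cong refl) (simp add: mult_ac)
    finally show ?thesis .
  qed
  have hb: "bounded_rv P (?h i j)" if "i < N" "j < N" for i j
    by (intro bounded_rv_mult bounded_rv_of_real bounded_rv_cnj bounded_rv_norm
          bounded_rv_diff bounded_rv_power bounded_rv_const Z_bounded likelihood_bounded overlap_bounded uc that)
  have "complex_of_real ?E = expectation (\<lambda>\<omega>. complex_of_real (likelihood \<omega> * (cmod (moment (conj_diag \<omega>) u k - tilted_moment k))\<^sup>2))"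
    by (intro integral_of_real[symmetric] bounded_rv_integrable bounded_rv_mult likelihood_bounded
        bounded_rv_power bounded_rv_norm bounded_rv_diff moment_bounded uc bounded_rv_const)
  also have "\<dots> = expectation (\<lambda>\<omega>. \<Sum>i<N. \<Sum>j<N. ?h i j \<omega>)"
    by (rule Bochner_Integration.integral_cong[OF refl expand])
  also have "\<dots> = (\<Sum>i<N. \<Sum>j<N. expectation (?h i j))"
    using hb by (subst Bochner_Integration.integral_sum; (intro sum.cong refl Bochner_Integration.integral_sum
      Bochner_Integration.integrable_sum bounded_rv_integrable)?) auto
  also have "\<dots> = (\<Sum>i<N. \<Sum>j<N. if i = j then expectation (\<lambda>\<omega>. complex_of_real (?p i \<omega> * ?p i \<omega>)) * ?c else 0)"
  proof (intro sum.cong refl)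
    fix i j assume "i \<in> {..<N}" "j \<in> {..<N}"
    then have ij: "i < N" "j < N" by auto
    show "expectation (?h i j) = (if i = j then expectation (\<lambda>\<omega>. complex_of_real (?p i \<omega> * ?p i \<omega>)) * ?c else 0)"
      unfolding expectation_overlap_times_likelihood[OF uc ij] expectation_likelihood_centered[OF ij] by simp
  qed
  also have "\<dots> = of_real (\<Sum>i<N. expectation (\<lambda>\<omega>. cmod (overlap (V \<omega>) u i) ^ 4)) * ?c"
  proof -
    have "expectation (\<lambda>\<omega>. complex_of_real (?p i \<omega> * ?p i \<omega>)) = of_real (expectation (\<lambda>\<omega>. cmod (overlap (V \<omega>) u i) ^ 4))" for i
    proof -
      have "?p i \<omega> * ?p i \<omega> = cmod (overlap (V \<omega>) u i) ^ 4" for \<omega>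
        by (simp add: power4_eq_xxxx power2_eq_square mult.assoc)
      then show ?thesis by (simp only: integral_complex_of_real)
    qed
    then show ?thesis by (simp add: sum_distrib_right)
  qed
  finally have eq: "complex_of_real ?E = of_real (\<Sum>i<N. expectation (\<lambda>\<omega>. cmod (overlap (V \<omega>) u i) ^ 4)) * ?c" .
  have "?E \<le> cmod (complex_of_real ?E)" by simp
  also have "\<dots> \<le> (3 / real N) * 4"
    unfolding eq norm_mult norm_of_real
  proof (intro mult_mono tilted_variance_le)
    have "0 \<le> (\<Sum>i<N. expectation (\<lambda>\<omega>. cmod (overlap (V \<omega>) u i) ^ 4))"
      by (intro sum_nonneg Bochner_Integration.integral_nonneg) simp
    moreover have "(\<Sum>i<N. expectation (\<lambda>\<omega>. cmod (overlap (V \<omega>) u i) ^ 4)) \<le> (\<Sum>i<N. 3 / (real N)\<^sup>2)"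
      by (intro sum_mono expectation_overlap_fourth_le u) simp
    moreover have "(\<Sum>i<N. 3 / (real N)\<^sup>2) = 3 / real N" using N by (simp add: power2_eq_square)
    ultimately show "\<bar>\<Sum>i<N. expectation (\<lambda>\<omega>. cmod (overlap (V \<omega>) u i) ^ 4)\<bar> \<le> 3 / real N" by simp
  qed auto
  finally show ?thesis by simp
qed

lemma deviation_bounded:
  assumes "u \<in> carrier_vec N"
  shows "bounded_rv P (\<lambda>\<omega>. deviation N s (conj_diag \<omega>) u k)"
  unfolding deviation_def by (intro bounded_rv_diff bounded_rv_mult moment_bounded assms bounded_rv_const)

lemma tilted_deviation_le:
  assumes u: "u \<in> unit_vectors N" and k: "k \<ge> 1"
  shows "expectation (\<lambda>\<omega>. likelihood \<omega> * cmod (deviation N s (conj_diag \<omega>) u k)) \<le> 17"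
proof -
  have uc: "u \<in> carrier_vec N" using u by (simp add: unit_vectors_def)
  let ?X = "\<lambda>\<omega>. moment (conj_diag \<omega>) u k - tilted_moment k"
  let ?r = "of_real (sqrt (real N)) * tilted_moment k - (if k = 2 then of_real (s / 2) else 0)"
  let ?d = "\<lambda>\<omega>. deviation N s (conj_diag \<omega>) u k"
  note bounded = bounded_rv_mult bounded_rv_add likelihood_bounded bounded_rv_power bounded_rv_norm
    bounded_rv_diff bounded_rv_const moment_bounded[OF uc] deviation_bounded[OF uc]
  have ptwise: "cmod (?d \<omega>) \<le> 9 / 2 + real N * (cmod (?X \<omega>))\<^sup>2" for \<omega>
  proof -
    have "?d \<omega> = of_real (sqrt (real N)) * ?X \<omega> + ?r" by (simp add: deviation_def algebra_simps)
    then have "cmod (?d \<omega>) \<le> cmod (of_real (sqrt (real N)) * ?X \<omega>) + cmod ?r"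
      by (simp only: norm_triangle_ineq)
    also have "\<dots> \<le> sqrt (real N) * cmod (?X \<omega>) + 2"
      using tilted_moment_approx[OF k] by (simp add: norm_mult)
    also have "sqrt (real N) * cmod (?X \<omega>) \<le> 1 + real N * (cmod (?X \<omega>))\<^sup>2"
    proof -
      have "0 \<le> (sqrt (real N) * cmod (?X \<omega>) - 1)\<^sup>2" by simp
      then have "2 * (sqrt (real N) * cmod (?X \<omega>)) \<le> 1 + (sqrt (real N) * cmod (?X \<omega>))\<^sup>2"
        by (simp add: power2_eq_square algebra_simps)
      moreover have "(sqrt (real N) * cmod (?X \<omega>))\<^sup>2 = real N * (cmod (?X \<omega>))\<^sup>2"
        by (simp add: power_mult_distrib)
      moreover have "0 \<le> sqrt (real N) * cmod (?X \<omega>)" by simp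
      ultimately show ?thesis by linarith
    qed
    finally show ?thesis by simp
  qed
  have "expectation (\<lambda>\<omega>. likelihood \<omega> * cmod (?d \<omega>)) \<le>
      expectation (\<lambda>\<omega>. 9 / 2 * likelihood \<omega> + real N * (likelihood \<omega> * (cmod (?X \<omega>))\<^sup>2))"
  proof (rule integral_mono)
    show "integrable P (\<lambda>\<omega>. likelihood \<omega> * cmod (?d \<omega>))" by (intro bounded_rv_integrable bounded)
    show "integrable P (\<lambda>\<omega>. 9 / 2 * likelihood \<omega> + real N * (likelihood \<omega> * (cmod (?X \<omega>))\<^sup>2))"
      by (intro bounded_rv_integrable bounded)
    fix \<omega> assume "\<omega> \<in> space P"
    from mult_left_mono[OF ptwise likelihood_nonneg[OF this]]
    show "likelihood \<omega> * cmod (?d \<omega>) \<le> 9 / 2 * likelihood \<omega> + real N * (likelihood \<omega> * (cmod (?X \<omega>))\<^sup>2)"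
      by (simp add: algebra_simps)
  qed
  also have "\<dots> = expectation (\<lambda>\<omega>. 9 / 2 * likelihood \<omega>) + expectation (\<lambda>\<omega>. real N * (likelihood \<omega> * (cmod (?X \<omega>))\<^sup>2))"
    by (intro Bochner_Integration.integral_add bounded_rv_integrable bounded)
  also have "\<dots> = 9 / 2 + real N * expectation (\<lambda>\<omega>. likelihood \<omega> * (cmod (?X \<omega>))\<^sup>2)"
    by (simp add: expectation_likelihood)
  also have "\<dots> \<le> 9 / 2 + real N * (12 / real N)"
    by (intro add_left_mono mult_left_mono tilted_second_moment_le u) simp
  also have "\<dots> \<le> 17" using N by simp
  finally show ?thesis .
qed

lemma cmod_moment_model_le_1:
  "u \<in> unit_vectors N \<Longrightarrow> \<omega> \<in> space P \<Longrightarrow> cmod (moment (conj_diag \<omega>) u k) \<le> 1"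
  unfolding conj_diag_def using V_unitary Z_circle by (intro cmod_moment_le_1) auto

lemma total_deviation_bounded:
  assumes u: "u \<in> unit_vectors N" and \<rho>: "0 < \<rho>" "\<rho> < 1"
  shows "bounded_rv P (\<lambda>\<omega>. total_deviation N \<rho> s (conj_diag \<omega>) u)"
proof (rule bounded_rvI)
  have uc: "u \<in> carrier_vec N" using u by (simp add: unit_vectors_def)
  show "(\<lambda>\<omega>. total_deviation N \<rho> s (conj_diag \<omega>) u) \<in> borel_measurable P"
    unfolding total_deviation_def
    by (intro borel_measurable_suminf bounded_rv_measurable bounded_rv_mult bounded_rv_const
        bounded_rv_norm deviation_bounded uc)
  fix \<omega> assume \<omega>: "\<omega> \<in> space P"
  show "norm (total_deviation N \<rho> s (conj_diag \<omega>) u) \<le> (\<Sum>j. \<rho> ^ Suc j * (sqrt (real N) + \<bar>s\<bar>))"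
    unfolding total_deviation_def
  proof (rule norm_suminf_le)
    show "summable (\<lambda>j. \<rho> ^ Suc j * (sqrt (real N) + \<bar>s\<bar>))"
      using \<rho> by (intro summable_mult2) (simp add: summable_Suc_iff summable_geometric)
    show "norm (\<rho> ^ Suc j * cmod (deviation N s (conj_diag \<omega>) u (Suc j))) \<le> \<rho> ^ Suc j * (sqrt (real N) + \<bar>s\<bar>)" for j
      using \<rho> cmod_deviation_le[OF cmod_moment_model_le_1[OF u \<omega>, of "Suc j"], of N s]
      by (simp add: abs_mult mult_left_mono)
  qed
qed

lemma tilted_total_deviation_le:
  assumes u: "u \<in> unit_vectors N" and \<rho>: "0 < \<rho>" "\<rho> < 1"
  shows "expectation (\<lambda>\<omega>. likelihood \<omega> * total_deviation N \<rho> s (conj_diag \<omega>) u) \<le> 17 * (\<rho> / (1 - \<rho>))"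
proof -
  have uc: "u \<in> carrier_vec N" using u by (simp add: unit_vectors_def)
  let ?d = "\<lambda>\<omega> j. cmod (deviation N s (conj_diag \<omega>) u (Suc j))"
  let ?f = "\<lambda>j \<omega>. \<rho> ^ Suc j * (likelihood \<omega> * ?d \<omega> j)"
  have geo: "(\<lambda>j. \<rho> ^ Suc j * 17) sums (17 * (\<rho> / (1 - \<rho>)))"
  proof -
    have "(\<lambda>j. \<rho> ^ j * (17 * \<rho>)) sums (1 / (1 - \<rho>) * (17 * \<rho>))"
      using \<rho> by (intro sums_mult2 geometric_sums) simp
    then show ?thesis by (simp add: mult_ac)
  qed
  have int: "integrable P (?f j)" for j
    by (intro bounded_rv_integrable bounded_rv_mult bounded_rv_const bounded_rv_norm likelihood_bounded deviation_bounded uc)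
  have E: "expectation (?f j) \<le> \<rho> ^ Suc j * 17" for j
  proof -
    have "expectation (?f j) = \<rho> ^ Suc j * expectation (\<lambda>\<omega>. likelihood \<omega> * ?d \<omega> j)" by simp
    also have "\<dots> \<le> \<rho> ^ Suc j * 17"
      using \<rho> by (intro mult_left_mono tilted_deviation_le u) auto
    finally show ?thesis .
  qed
  have norm_f: "norm (?f j \<omega>) = ?f j \<omega>" if "\<omega> \<in> space P" for j \<omega>
    using likelihood_nonneg[OF that] \<rho> by (simp add: abs_mult)
  then have En: "expectation (\<lambda>\<omega>. norm (?f j \<omega>)) = expectation (?f j)" for j
    by (intro Bochner_Integration.integral_cong refl)
  have E0: "0 \<le> expectation (?f j)" for j
    unfolding En[symmetric] by (rule Bochner_Integration.integral_nonneg) (rule norm_ge_zero)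
  have sumE: "summable (\<lambda>j. expectation (?f j))"
    using E E0 by (intro summable_comparison_test'[OF sums_summable[OF geo]]) simp
  have sumd: "summable (\<lambda>j. \<rho> ^ Suc j * ?d \<omega> j)" if "\<omega> \<in> space P" for \<omega>
    using \<rho> by (intro summable_deviation cmod_moment_model_le_1 u that) auto
  have f_eq: "?f j \<omega> = likelihood \<omega> * (\<rho> ^ Suc j * ?d \<omega> j)" for j \<omega> by simp
  have "expectation (\<lambda>\<omega>. likelihood \<omega> * total_deviation N \<rho> s (conj_diag \<omega>) u) = expectation (\<lambda>\<omega>. \<Sum>j. ?f j \<omega>)"
    unfolding total_deviation_def f_eq
    by (intro Bochner_Integration.integral_cong refl suminf_mult[symmetric] sumd)
  also have "\<dots> = (\<Sum>j. expectation (?f j))"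
  proof (rule integral_suminf[OF int])
    show "AE \<omega> in P. summable (\<lambda>j. norm (?f j \<omega>))"
    proof (rule AE_I2)
      fix \<omega> assume \<omega>: "\<omega> \<in> space P"
      show "summable (\<lambda>j. norm (?f j \<omega>))"
        unfolding norm_f[OF \<omega>] unfolding f_eq by (intro summable_mult sumd \<omega>)
    qed
    show "summable (\<lambda>j. expectation (\<lambda>\<omega>. norm (?f j \<omega>)))" unfolding En by (rule sumE)
  qed
  also have "\<dots> \<le> (\<Sum>j. \<rho> ^ Suc j * 17)"
    by (rule suminf_le[OF E sumE sums_summable[OF geo]])
  also have "\<dots> = 17 * (\<rho> / (1 - \<rho>))" using geo by (simp add: sums_iff)
  finally show ?thesis .
qed

text \<open>
  Markov's inequality gives the event \<open>B\<close> a tilted probability \<open>E[L 1\<^sub>B] \<ge> 1/2\<close>. The elementary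
  inequality \<open>L 1\<^sub>B \<le> L\<^sup>2 / (4 \<Lambda>) + \<Lambda> 1\<^sub>B\<close> with \<open>\<Lambda> = exp (4 s\<^sup>2) \<ge> E[L\<^sup>2]\<close> transfers this to the original
  probability.
\<close>
lemma prob_small_total_deviation:
  assumes u: "u \<in> unit_vectors N" and \<rho>: "0 < \<rho>" "\<rho> < 1"
  shows "prob {\<omega> \<in> space P. total_deviation N \<rho> s (conj_diag \<omega>) u \<le> 34 * (\<rho> / (1 - \<rho>))} \<ge> exp (- (4 * s\<^sup>2)) / 4"
proof -
  let ?T = "\<lambda>\<omega>. total_deviation N \<rho> s (conj_diag \<omega>) u"
  let ?r = "\<rho> / (1 - \<rho>)"
  let ?B = "{\<omega> \<in> space P. ?T \<omega> \<le> 34 * ?r}"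
  let ?I = "indicator ?B :: 'w \<Rightarrow> real"
  define \<Lambda> where "\<Lambda> = exp (4 * s\<^sup>2)"
  have \<Lambda>: "\<Lambda> > 0" by (simp add: \<Lambda>_def)
  have r: "?r > 0" using \<rho> by simp
  have Tb: "bounded_rv P ?T" by (rule total_deviation_bounded[OF u \<rho>])
  have [measurable]: "?T \<in> borel_measurable P" by (rule bounded_rv_measurable[OF Tb])
  have B: "?B \<in> events" by measurable
  have Ib: "bounded_rv P ?I" using B by (intro bounded_rvI[where B = 1]) (auto simp: indicator_def)
  have T0: "0 \<le> ?T \<omega>" if "\<omega> \<in> space P" for \<omega>
    unfolding total_deviation_def using \<rho>
    by (intro suminf_nonneg summable_deviation cmod_moment_model_le_1 u that) auto
  note bounded = bounded_rv_mult bounded_rv_add likelihood_bounded bounded_rv_power bounded_rv_diff bounded_rv_const Ib Tb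
  have "34 * ?r * expectation (\<lambda>\<omega>. likelihood \<omega> - likelihood \<omega> * ?I \<omega>) = expectation (\<lambda>\<omega>. 34 * ?r * (likelihood \<omega> - likelihood \<omega> * ?I \<omega>))"
    by simp
  also have "\<dots> \<le> expectation (\<lambda>\<omega>. likelihood \<omega> * ?T \<omega>)"
  proof (rule integral_mono)
    fix \<omega> assume \<omega>: "\<omega> \<in> space P"
    show "34 * ?r * (likelihood \<omega> - likelihood \<omega> * ?I \<omega>) \<le> likelihood \<omega> * ?T \<omega>"
    proof (cases "\<omega> \<in> ?B")
      case True
      then show ?thesis using likelihood_nonneg[OF \<omega>] T0[OF \<omega>] by simp
    next
      case False
      then have "34 * ?r \<le> ?T \<omega>" using \<omega> by simp
      then have "likelihood \<omega> * (34 * ?r) \<le> likelihood \<omega> * ?T \<omega>"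
        by (rule mult_left_mono) (rule likelihood_nonneg[OF \<omega>])
      moreover have "?I \<omega> = 0" using False by (auto simp: indicator_def)
      ultimately show ?thesis by (simp add: mult_ac)
    qed
  qed (intro bounded_rv_integrable bounded)+
  also have "\<dots> \<le> 17 * ?r" by (rule tilted_total_deviation_le[OF u \<rho>])
  finally have tail: "34 * ?r * expectation (\<lambda>\<omega>. likelihood \<omega> - likelihood \<omega> * ?I \<omega>) \<le> 17 * ?r" .
  have "x \<le> 1 / 2" if "34 * r * x \<le> 17 * r" "0 < r" for r x :: real
  proof -
    have "r * (2 * x) \<le> r * 1" using that(1) by simp
    then have "2 * x \<le> 1" using that(2) by (simp only: mult_le_cancel_left_pos)
    then show ?thesis by simp
  qed
  from this[OF tail r]
  have "expectation (\<lambda>\<omega>. likelihood \<omega> - likelihood \<omega> * ?I \<omega>) \<le> 1 / 2" .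
  also have "expectation (\<lambda>\<omega>. likelihood \<omega> - likelihood \<omega> * ?I \<omega>) = expectation likelihood - expectation (\<lambda>\<omega>. likelihood \<omega> * ?I \<omega>)"
    by (intro Bochner_Integration.integral_diff bounded_rv_integrable bounded)
  finally have "1 / 2 \<le> expectation (\<lambda>\<omega>. likelihood \<omega> * ?I \<omega>)" by (simp add: expectation_likelihood)
  also have "\<dots> \<le> expectation (\<lambda>\<omega>. (likelihood \<omega>)\<^sup>2 * inverse (4 * \<Lambda>) + \<Lambda> * ?I \<omega>)"
  proof (rule integral_mono)
    fix \<omega>
    \<comment> \<open>the case of an outcome in the event is the inequality between arithmetic and geometric means\<close>
    have "0 \<le> (likelihood \<omega> - 2 * \<Lambda>)\<^sup>2 / (4 * \<Lambda>)" using \<Lambda> by simp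
    also have "(likelihood \<omega> - 2 * \<Lambda>)\<^sup>2 / (4 * \<Lambda>) = (likelihood \<omega>)\<^sup>2 / (4 * \<Lambda>) + \<Lambda> - likelihood \<omega>"
      using \<Lambda> by (simp add: field_simps power2_eq_square)
    finally show "likelihood \<omega> * ?I \<omega> \<le> (likelihood \<omega>)\<^sup>2 * inverse (4 * \<Lambda>) + \<Lambda> * ?I \<omega>"
      unfolding divide_inverse[symmetric] using \<Lambda> by (cases "\<omega> \<in> ?B") (auto simp: indicator_def)
    show "integrable P (\<lambda>\<omega>. (likelihood \<omega>)\<^sup>2 * inverse (4 * \<Lambda>) + \<Lambda> * ?I \<omega>)"
      by (intro bounded_rv_integrable bounded)
  qed (intro bounded_rv_integrable bounded)
  also have "\<dots> = expectation (\<lambda>\<omega>. (likelihood \<omega>)\<^sup>2 * inverse (4 * \<Lambda>)) + expectation (\<lambda>\<omega>. \<Lambda> * ?I \<omega>)"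
    by (intro Bochner_Integration.integral_add bounded_rv_integrable bounded)
  also have "\<dots> = expectation (\<lambda>\<omega>. (likelihood \<omega>)\<^sup>2) * inverse (4 * \<Lambda>) + \<Lambda> * prob ?B"
    using B by simp
  also have "\<dots> \<le> \<Lambda> * inverse (4 * \<Lambda>) + \<Lambda> * prob ?B"
    using \<Lambda> expectation_likelihood_sq unfolding \<Lambda>_def[symmetric] by (intro add_right_mono mult_right_mono) auto
  also have "\<Lambda> * inverse (4 * \<Lambda>) = 1 / 4" using \<Lambda> by simp
  finally have "1 / 4 \<le> \<Lambda> * prob ?B" by simp
  then have "1 / 4 / \<Lambda> \<le> prob ?B" unfolding pos_divide_le_eq[OF \<Lambda>] by (simp only: mult.commute)
  moreover have "exp (- (4 * s\<^sup>2)) / 4 = 1 / 4 / \<Lambda>" by (simp add: \<Lambda>_def exp_minus field_simps)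
  ultimately show ?thesis by (simp only:)
qed

end
end

section \<open>A random direction\<close>

lemma borel_mat_power_entry:
  assumes "i < N" "j < N"
  shows "(\<lambda>A. (A ^\<^sub>m k) $$ (i, j)) \<in> borel_measurable (borel_mat N)"
  using assms
proof (induction k arbitrary: i j)
  case 0
  have "(\<lambda>A :: complex Matrix.mat. if i = j then 1 else 0 :: complex) \<in> borel_measurable (borel_mat N)" by simp
  then show ?case
    by (rule measurable_cong[THEN iffD1, rotated]) (use 0 in auto)
next
  case (Suc k)
  have "(\<lambda>A. \<Sum>l<N. (A ^\<^sub>m k) $$ (i, l) * A $$ (l, j)) \<in> borel_measurable (borel_mat N)"
    using Suc by (intro borel_measurable_sum borel_measurable_times borel_mat_entry) auto
  then show ?case
  proof (rule measurable_cong[THEN iffD1, rotated])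
    fix A :: "complex Matrix.mat" assume "A \<in> space (borel_mat N)"
    then have A: "A \<in> carrier_mat N N" by simp
    show "(\<Sum>l<N. (A ^\<^sub>m k) $$ (i, l) * A $$ (l, j)) = (A ^\<^sub>m Suc k) $$ (i, j)"
      using mat_mult_entry[OF pow_carrier_mat[OF A] A Suc.prems, of k] by simp
  qed
qed

lemma moment_measurable_pair:
  "(\<lambda>x. moment (fst x) (snd x) k) \<in> borel_measurable (borel_mat N \<Otimes>\<^sub>M borel_vec N)"
proof -
  have cnj: "cnj \<in> borel_measurable borel"
    by (intro borel_measurable_continuous_onI continuous_intros)
  have "(\<lambda>x. \<Sum>i<N. (\<Sum>j<N. (fst x ^\<^sub>m k) $$ (i, j) * snd x $ j) * cnj (snd x $ i))
      \<in> borel_measurable (borel_mat N \<Otimes>\<^sub>M borel_vec N)"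
    by (intro borel_measurable_sum borel_measurable_times measurable_compose[OF measurable_fst borel_mat_power_entry]
        measurable_compose[OF measurable_snd borel_vec_entry] measurable_compose[OF _ cnj]) auto
  then show ?thesis
  proof (rule measurable_cong[THEN iffD1, rotated])
    fix x :: "complex Matrix.mat \<times> complex Matrix.vec"
    assume "x \<in> space (borel_mat N \<Otimes>\<^sub>M borel_vec N)"
    then have x: "fst x \<in> carrier_mat N N" "snd x \<in> carrier_vec N" by (auto simp: space_pair_measure)
    show "(\<Sum>i<N. (\<Sum>j<N. (fst x ^\<^sub>m k) $$ (i, j) * snd x $ j) * cnj (snd x $ i)) = moment (fst x) (snd x) k"
      using x pow_carrier_mat[OF x(1), of k] by (simp add: moment_def scalar_prod_def atLeast0LessThan)
  qed
qed

lemma total_deviation_measurable_pair: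
  "(\<lambda>x. total_deviation N \<rho> s (fst x) (snd x)) \<in> borel_measurable (borel_mat N \<Otimes>\<^sub>M borel_vec N)"
  unfolding total_deviation_def deviation_def
  by (intro borel_measurable_suminf borel_measurable_times measurable_compose[OF _ borel_measurable_norm] borel_measurable_diff
      borel_measurable_const moment_measurable_pair)

text \<open>
  The product form of the joint law lets Fubini's theorem integrate a bound for fixed vectors.
\<close>
lemma (in prob_space) indep_rv_distr_pair:
  assumes "indep_rv M S X T Y"
  shows "distr M (T \<Otimes>\<^sub>M S) (\<lambda>\<omega>. (Y \<omega>, X \<omega>)) = distr M T Y \<Otimes>\<^sub>M distr M S X"
proof -
  have X: "X \<in> measurable M S" and Y: "Y \<in> measurable M T"
    and ind: "indep_set {X -` B \<inter> space M | B. B \<in> sets S} {Y -` B \<inter> space M | B. B \<in> sets T}"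
    using assms by (auto simp: indep_rv_def)
  interpret X: prob_space "distr M S X" by (rule prob_space_distr[OF X])
  interpret Y: prob_space "distr M T Y" by (rule prob_space_distr[OF Y])
  show ?thesis
  proof (rule pair_measure_eqI[symmetric])
    fix B A assume BA: "B \<in> sets (distr M T Y)" "A \<in> sets (distr M S X)"
    then have sets: "B \<in> sets T" "A \<in> sets S" by auto
    have XA: "X -` A \<inter> space M \<in> events" and YB: "Y -` B \<inter> space M \<in> events"
      using sets X Y by (auto intro: measurable_sets)
    have "prob ((X -` A \<inter> space M) \<inter> (Y -` B \<inter> space M)) = prob (X -` A \<inter> space M) * prob (Y -` B \<inter> space M)"
      by (rule indep_setD[OF ind]) (use sets in auto)
    moreover have "(X -` A \<inter> space M) \<inter> (Y -` B \<inter> space M) = (\<lambda>\<omega>. (Y \<omega>, X \<omega>)) -` (B \<times> A) \<inter> space M" by auto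
    ultimately show "emeasure (distr M T Y) B * emeasure (distr M S X) A =
        emeasure (distr M (T \<Otimes>\<^sub>M S) (\<lambda>\<omega>. (Y \<omega>, X \<omega>))) (B \<times> A)"
      using sets X Y by (simp add: emeasure_distr emeasure_eq_measure ennreal_mult' mult.commute)
  qed (simp_all add: X.sigma_finite_measure_axioms Y.sigma_finite_measure_axioms cong: sets_pair_measure_cong)
qed

context haar_diagonal_model
begin

lemma conj_diag_measurable: "conj_diag \<in> measurable P (borel_mat N)"
proof (rule measurable_borel_mat)
  have c: "V \<omega> \<in> carrier_mat N N" "mat_adjoint (V \<omega>) \<in> carrier_mat N N" if "\<omega> \<in> space P" for \<omega>
    using unitary_groupD[OF V_unitary[OF that]] by blast+
  show "conj_diag \<omega> \<in> carrier_mat N N" if "\<omega> \<in> space P" for \<omega>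
    unfolding conj_diag_def using c[OF that] by (intro mult_carrier_mat[of _ N N] mat_diag_dim)
  fix i j assume ij: "i < N" "j < N"
  have cnj: "cnj \<in> borel_measurable borel"
    by (intro borel_measurable_continuous_onI continuous_intros)
  have "(\<lambda>\<omega>. \<Sum>l<N. V \<omega> $$ (i, l) * Z l \<omega> * cnj (V \<omega> $$ (j, l))) \<in> borel_measurable P"
    by (intro borel_measurable_sum borel_measurable_times measurable_compose[OF V_meas borel_unitary_entry]
      measurable_compose[OF _ cnj] Z_meas) (use ij in auto)
  then show "(\<lambda>\<omega>. conj_diag \<omega> $$ (i, j)) \<in> borel_measurable P"
  proof (rule measurable_cong[THEN iffD1, rotated])
    fix \<omega> assume "\<omega> \<in> space P"
    note c = c[OF this]
    show "(\<Sum>l<N. V \<omega> $$ (i, l) * Z l \<omega> * cnj (V \<omega> $$ (j, l))) = conj_diag \<omega> $$ (i, j)"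
      unfolding conj_diag_def mat_mult_entry[OF mult_carrier_mat[OF c(1) mat_diag_dim] c(2) ij]
      unfolding mat_diag_mult_right[OF c(1)]
      using c ij by (intro sum.cong) auto
  qed
qed

text \<open>
  The bound for a fixed vector is uniform, so for a random vector independent of \<open>M\<close> it can be
  integrated against the law of the vector.
\<close>
lemma prob_small_total_deviation_random_vector:
  assumes s: "0 \<le> s" "4 * s\<^sup>2 \<le> real N" and \<rho>: "0 < \<rho>" "\<rho> < 1"
    and v: "\<And>\<omega>. \<omega> \<in> space P \<Longrightarrow> v \<omega> \<in> unit_vectors N"
    and cases: "(\<exists>u. \<forall>\<omega>\<in>space P. v \<omega> = u) \<or> indep_rv P (borel_vec N) v (borel_mat N) conj_diag"
  defines "B \<equiv> {\<omega> \<in> space P. total_deviation N \<rho> s (conj_diag \<omega>) (v \<omega>) \<le> 34 * (\<rho> / (1 - \<rho>))}"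
  shows "B \<in> events" "prob B \<ge> exp (- (4 * s\<^sup>2)) / 4"
proof -
  have v_meas: "v \<in> measurable P (borel_vec N)"
    using cases
  proof
    assume "\<exists>u. \<forall>\<omega>\<in>space P. v \<omega> = u"
    then obtain u where u: "\<And>\<omega>. \<omega> \<in> space P \<Longrightarrow> v \<omega> = u" by blast
    obtain \<omega> where "\<omega> \<in> space P" using not_empty by blast
    then have "u \<in> space (borel_vec N)" using u v by (auto simp: unit_vectors_def)
    then have "(\<lambda>_. u) \<in> measurable P (borel_vec N)" by simp
    then show ?thesis by (rule measurable_cong[THEN iffD1, rotated]) (simp add: u)
  qed (simp add: indep_rv_def)
  have pair: "(\<lambda>\<omega>. (conj_diag \<omega>, v \<omega>)) \<in> measurable P (borel_mat N \<Otimes>\<^sub>M borel_vec N)"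
    by (intro measurable_Pair conj_diag_measurable v_meas)
  let ?T = "\<lambda>x. total_deviation N \<rho> s (fst x) (snd x)"
  define S where "S = {x \<in> space (borel_mat N \<Otimes>\<^sub>M borel_vec N). ?T x \<le> 34 * (\<rho> / (1 - \<rho>))}"
  have S: "S \<in> sets (borel_mat N \<Otimes>\<^sub>M borel_vec N)"
  proof -
    have [measurable]: "?T \<in> borel_measurable (borel_mat N \<Otimes>\<^sub>M borel_vec N)" by (rule total_deviation_measurable_pair)
    show ?thesis unfolding S_def by measurable
  qed
  have B_eq: "B = (\<lambda>\<omega>. (conj_diag \<omega>, v \<omega>)) -` S \<inter> space P"
    using measurable_space[OF pair] by (auto simp: B_def S_def)
  show B: "B \<in> events" unfolding B_eq by (rule measurable_sets[OF pair S])
  show "prob B \<ge> exp (- (4 * s\<^sup>2)) / 4"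
    using cases
  proof
    assume "\<exists>u. \<forall>\<omega>\<in>space P. v \<omega> = u"
    then obtain u where u: "\<And>\<omega>. \<omega> \<in> space P \<Longrightarrow> v \<omega> = u" by blast
    obtain \<omega> where "\<omega> \<in> space P" using not_empty by blast
    then have "u \<in> unit_vectors N" using u v by auto
    moreover have "B = {\<omega> \<in> space P. total_deviation N \<rho> s (conj_diag \<omega>) u \<le> 34 * (\<rho> / (1 - \<rho>))}"
      using u by (auto simp: B_def)
    ultimately show ?thesis using prob_small_total_deviation[OF s _ \<rho>] by simp
  next
    assume ind: "indep_rv P (borel_vec N) v (borel_mat N) conj_diag"
    let ?\<mu> = "distr P (borel_mat N) conj_diag" and ?\<nu> = "distr P (borel_vec N) v"
    interpret \<mu>: prob_space ?\<mu> by (rule prob_space_distr[OF conj_diag_measurable])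
    interpret \<nu>: prob_space ?\<nu> by (rule prob_space_distr[OF v_meas])
    interpret pair_sigma_finite ?\<mu> ?\<nu> ..
    let ?c = "ennreal (exp (- (4 * s\<^sup>2)) / 4)"
    have S': "S \<in> sets (?\<mu> \<Otimes>\<^sub>M ?\<nu>)" using S by (simp cong: sets_pair_measure_cong)
    have "emeasure P B = emeasure (distr P (borel_mat N \<Otimes>\<^sub>M borel_vec N) (\<lambda>\<omega>. (conj_diag \<omega>, v \<omega>))) S"
      unfolding B_eq by (rule emeasure_distr[OF pair S, symmetric])
    also have "\<dots> = emeasure (?\<mu> \<Otimes>\<^sub>M ?\<nu>) S" unfolding indep_rv_distr_pair[OF ind] ..
    also have "\<dots> = (\<integral>\<^sup>+u. emeasure ?\<mu> ((\<lambda>A. (A, u)) -` S) \<partial>?\<nu>)"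
      by (rule emeasure_pair_measure_alt2[OF S'])
    also have "\<dots> = (\<integral>\<^sup>+\<omega>. emeasure ?\<mu> ((\<lambda>A. (A, v \<omega>)) -` S) \<partial>P)"
      using measurable_emeasure_Pair2[OF S'] by (intro nn_integral_distr v_meas) simp
    also have "\<dots> \<ge> (\<integral>\<^sup>+\<omega>. ?c \<partial>P)"
    proof (rule nn_integral_mono)
      fix \<omega>0 assume "\<omega>0 \<in> space P"
      then have u: "v \<omega>0 \<in> unit_vectors N" by (rule v)
      have Su: "(\<lambda>A. (A, v \<omega>0)) -` S \<in> sets (borel_mat N)"
        using sets_Pair2[OF S'] by simp
      have "?c \<le> emeasure P {\<omega> \<in> space P. total_deviation N \<rho> s (conj_diag \<omega>) (v \<omega>0) \<le> 34 * (\<rho> / (1 - \<rho>))}"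
        unfolding emeasure_eq_measure by (intro ennreal_leI prob_small_total_deviation[OF s u \<rho>])
      also have "{\<omega> \<in> space P. total_deviation N \<rho> s (conj_diag \<omega>) (v \<omega>0) \<le> 34 * (\<rho> / (1 - \<rho>))} =
          conj_diag -` ((\<lambda>A. (A, v \<omega>0)) -` S) \<inter> space P"
        using u measurable_space[OF conj_diag_measurable]
        by (auto simp: S_def space_pair_measure unit_vectors_def)
      also have "emeasure P \<dots> = emeasure ?\<mu> ((\<lambda>A. (A, v \<omega>0)) -` S)"
        by (rule emeasure_distr[OF conj_diag_measurable Su, symmetric])
      finally show "?c \<le> emeasure ?\<mu> ((\<lambda>A. (A, v \<omega>0)) -` S)" .
    qed
    finally have "?c \<le> emeasure P B" by (simp add: emeasure_space_1)
    then show ?thesis by (simp add: emeasure_eq_measure)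
  qed
qed

end

section \<open>Absence of a strongly separated outlier\<close>

lemma eig_count_mono:
  assumes "A \<in> carrier_mat N N" "S \<subseteq> T"
  shows "eig_count A S \<le> eig_count A T"
  unfolding eig_count_def using card_finite_spectrum(1)[OF assms(1)] assms(2)
  by (intro sum_mono2) auto

text \<open>
  The inner approximations have probability tending to 1 but avoid an event of probability at
  least \<open>c\<close>.
\<close>
lemma not_with_high_probability:
  assumes P: "\<And>N. N \<ge> 1 \<Longrightarrow> prob_space (P N)" and c: "c > 0"
    and ev: "\<forall>\<^sub>F N in sequentially. \<exists>B\<in>sets (P N). c \<le> measure (P N) B \<and> B \<inter> \<Omega> N = {}"
  shows "\<not> with_high_probability P \<Omega>"
proof
  assume "with_high_probability P \<Omega>"
  then obtain E where E: "\<And>N. E N \<in> sets (P N)" "\<And>N. E N \<subseteq> \<Omega> N"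
    and lim: "(\<lambda>N. measure (P N) (E N)) \<longlonglongrightarrow> 1"
    unfolding with_high_probability_def by blast
  have "\<forall>\<^sub>F N in sequentially. measure (P N) (E N) \<le> 1 - c"
    using ev eventually_ge_at_top[of 1]
  proof eventually_elim
    case (elim N)
    interpret prob_space "P N" by (rule P) (use elim in simp)
    from elim(1) obtain B where B: "B \<in> events" "c \<le> prob B" "B \<inter> \<Omega> N = {}" by blast
    then have "E N \<inter> B = {}" using E(2)[of N] by blast
    then have "prob (E N) + prob B = prob (E N \<union> B)" using E(1) B(1) by (intro finite_measure_Union[symmetric])
    also have "\<dots> \<le> 1" by simp
    finally show ?case using B(2) by simp
  qed
  then have "1 \<le> 1 - c" by (rule tendsto_upperbound[OF lim]) simp
  with c show False by simp
qed

lemma eventually_moment_le: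
  fixes Z :: "nat \<Rightarrow> nat \<Rightarrow> 'w \<Rightarrow> complex"
  assumes P: "\<And>N. N \<ge> 1 \<Longrightarrow> prob_space (P N)"
    and Z: "\<And>N \<omega>. N \<ge> 1 \<Longrightarrow> \<omega> \<in> space (P N) \<Longrightarrow> cmod (Z N 0 \<omega>) = 1"
    and small: "(\<lambda>N. SUP k\<in>{1::nat..}. cmod (LINT \<omega>|P N. Z N 0 \<omega> ^ k)) \<in> o(\<lambda>N. real N powi (- 1))"
  shows "\<forall>\<^sub>F N in sequentially. \<forall>k\<ge>1. cmod (LINT \<omega>|P N. Z N 0 \<omega> ^ k) \<le> 1 / real N"
proof -
  have "\<forall>\<^sub>F N in sequentially. norm (SUP k\<in>{1::nat..}. cmod (LINT \<omega>|P N. Z N 0 \<omega> ^ k)) \<le>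
      1 * norm (real N powi (- 1))"
    by (rule landau_o.smallD[OF small]) simp
  then show ?thesis
    using eventually_ge_at_top[of 1]
  proof eventually_elim
    case (elim N)
    interpret prob_space "P N" by (rule P) (use elim in simp)
    let ?f = "\<lambda>k. cmod (LINT \<omega>|P N. Z N 0 \<omega> ^ k)"
    have "?f k \<le> 1" for k
    proof -
      have "?f k \<le> expectation (\<lambda>\<omega>. cmod (Z N 0 \<omega> ^ k))" by (rule integral_norm_bound)
      also have "\<dots> = expectation (\<lambda>\<omega>. 1)"
        by (rule Bochner_Integration.integral_cong) (use Z elim in \<open>auto simp: norm_power\<close>)
      finally show ?thesis by (simp add: prob_space)
    qed
    then have bdd: "bdd_above (?f ` {1..})" by (intro bdd_aboveI2[where M = 1])
    have "?f k \<le> 1 / real N" if "k \<ge> 1" for k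
    proof -
      have "?f k \<le> (SUP k\<in>{1..}. ?f k)" by (rule cSUP_upper[OF _ bdd]) (use that in simp)
      also have "\<dots> \<le> norm (SUP k\<in>{1..}. ?f k)" by simp
      also have "\<dots> \<le> 1 * norm (real N powi (- 1))" by (rule elim(1))
      finally show ?thesis by (simp add: power_int_minus inverse_eq_divide)
    qed
    then show ?case by blast
  qed
qed

theorem theorem21:
  fixes a :: real
    and P :: "nat \<Rightarrow> 'w measure"
    and V D M :: "nat \<Rightarrow> 'w \<Rightarrow> complex Matrix.mat"
    and Z :: "nat \<Rightarrow> nat \<Rightarrow> 'w \<Rightarrow> complex"
    and v :: "nat \<Rightarrow> 'w \<Rightarrow> complex Matrix.vec"
    and A G :: "nat \<Rightarrow> real \<Rightarrow> 'w \<Rightarrow> complex Matrix.mat"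
  assumes a: "a \<noteq> 0"
    and prob: "\<And>N. N \<ge> 1 \<Longrightarrow> prob_space (P N)"
    and V_meas: "\<And>N. N \<ge> 1 \<Longrightarrow> V N \<in> measurable (P N) (borel_unitary N)"
    and V_haar: "\<And>N. N \<ge> 1 \<Longrightarrow> haar_unitary N (distr (P N) (borel_unitary N) (V N))"
    and Z_circle: "\<And>N i \<omega>. N \<ge> 1 \<Longrightarrow> i < N \<Longrightarrow> \<omega> \<in> space (P N) \<Longrightarrow> cmod (Z N i \<omega>) = 1"
    and Z_indep: "\<And>N. N \<ge> 1 \<Longrightarrow> prob_space.indep_vars (P N) (\<lambda>_. borel) (Z N) {..<N}"
    and Z_ident: "\<And>N i. N \<ge> 1 \<Longrightarrow> i < N \<Longrightarrow> distr (P N) borel (Z N i) = distr (P N) borel (Z N 0)"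
    and D: "\<And>N \<omega>. D N \<omega> = mat_diag N (\<lambda>i. Z N i \<omega>)"
    and VD_indep: "\<And>N. N \<ge> 1 \<Longrightarrow>
      prob_space.indep_var (P N) (borel_unitary N) (V N) (borel_mat N) (D N)"
    and M: "\<And>N \<omega>. M N \<omega> = V N \<omega> * D N \<omega> * mat_adjoint (V N \<omega>)"
    and simple: "\<And>N. N \<ge> 1 \<Longrightarrow> (AE \<omega> in P N. simple_spectrum (D N \<omega>))"
    and moments: "\<And>b :: int.
      (\<lambda>N. SUP k\<in>{1::nat..}. cmod (LINT \<omega>|P N. Z N 0 \<omega> ^ k)) \<in> o(\<lambda>N. real N powi (- b))"
    and v_unit: "\<And>N \<omega>. N \<ge> 1 \<Longrightarrow> \<omega> \<in> space (P N) \<Longrightarrow> v N \<omega> \<in> unit_vectors N"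
    and v_cases: "\<And>N. N \<ge> 1 \<Longrightarrow>
      (\<exists>u. \<forall>\<omega>\<in>space (P N). v N \<omega> = u) \<or>
      (indep_rv (P N) (borel_vec N) (v N) (borel_mat N) (M N) \<and>
       (\<exists>f :: complex Matrix.vec \<Rightarrow> real.
          (\<forall>x\<in>unit_vectors N. f x > 0) \<and>
          distributed (P N) (uniform_sphere N) (v N) (\<lambda>x. ennreal (f x))))"
    and A: "\<And>N t \<omega>. A N t \<omega> = 1\<^sub>m N - complex_of_real (1 - t) \<cdot>\<^sub>m proj_mat (v N \<omega>)"
    and G: "\<And>N t \<omega>. G N t \<omega> = M N \<omega> * A N t \<omega>"
  shows "\<not> strongly_separated_outlier P G (\<lambda>N. {a * real N powr (- 1 / 2)})"
proof
  assume "strongly_separated_outlier P G (\<lambda>N. {a * real N powr (- 1 / 2)})"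
  then obtain \<alpha>1 \<alpha>2 d1 d2 :: real where d1: "0 < d1" "d1 < 1"
    and whp: "with_high_probability P (\<lambda>N. {\<omega> \<in> space (P N). \<forall>t\<in>{a * real N powr (- 1 / 2)}.
      eig_count (G N t \<omega>) (ball 0 (d1 * (real N powr \<alpha>1 / (1 + real N powr \<alpha>1)))) = 1 \<and>
      eig_count (G N t \<omega>) (ball 0 1 - ball 0 (d2 * (real N powr \<alpha>2 / (1 + real N powr \<alpha>2)))) = N - 1})"
    unfolding strongly_separated_outlier_def by auto
  let ?\<Omega> = "\<lambda>N. {\<omega> \<in> space (P N). \<forall>t\<in>{a * real N powr (- 1 / 2)}.
      eig_count (G N t \<omega>) (ball 0 (d1 * (real N powr \<alpha>1 / (1 + real N powr \<alpha>1)))) = 1 \<and>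
      eig_count (G N t \<omega>) (ball 0 1 - ball 0 (d2 * (real N powr \<alpha>2 / (1 + real N powr \<alpha>2)))) = N - 1}"
  define t where "t = (\<lambda>N. a * real N powr (- 1 / 2))"
  define r where "r = (\<lambda>N. d1 * (real N powr \<alpha>1 / (1 + real N powr \<alpha>1)))"
  \<comment> \<open>for \<open>\<alpha>1 \<ge> 0\<close> a fixed radius, at most all \<open>r N\<close>, because \<open>s\<close> must not depend on \<open>N\<close>\<close>
  define \<rho> where "\<rho> = (if \<alpha>1 \<ge> 0 then (\<lambda>_. d1 / 2) else r)"
  define \<kappa> where "\<kappa> = (\<lambda>\<rho>. 34 * (\<rho> / (1 - \<rho>)) :: real)"
  \<comment> \<open>chosen so that the quadratic term \<open>(s/2) \<rho>\<^sup>2\<close> exceeds \<open>2|a|\<close> plus the admissible deviation; the factor 2 absorbs \<open>1 - t \<ge> 1/2\<close>\<close>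
  define s where "s = (if \<alpha>1 \<ge> 0 then 2 * (2 * \<bar>a\<bar> + \<kappa> (d1 / 2) + 1) / (d1 / 2)\<^sup>2 else 0)"
  have s0: "0 \<le> s" using d1 by (simp add: s_def \<kappa>_def)
  have r_pos: "0 < r N \<and> r N < 1" if "N \<ge> 1" for N
  proof -
    have p: "real N powr \<alpha>1 > 0" using that by simp
    then have "0 < real N powr \<alpha>1 / (1 + real N powr \<alpha>1)" "real N powr \<alpha>1 / (1 + real N powr \<alpha>1) < 1"
      by (auto simp: field_simps add_pos_pos)
    then show ?thesis
      unfolding r_def using d1 mult_strict_mono[of d1 1 "real N powr \<alpha>1 / (1 + real N powr \<alpha>1)" 1]
        mult_pos_pos[of d1 "real N powr \<alpha>1 / (1 + real N powr \<alpha>1)"] by simp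
  qed
  have \<rho>: "0 < \<rho> N" "\<rho> N < 1" if "N \<ge> 1" for N
    using r_pos[OF that] d1 by (auto simp: \<rho>_def)
  have sqrt_t: "\<bar>t N\<bar> * sqrt (real N) = \<bar>a\<bar>" if "N \<ge> 1" for N
    using that by (simp add: t_def abs_mult powr_minus powr_half_sqrt)
  have t_small: "\<forall>\<^sub>F N in sequentially. \<bar>t N\<bar> \<le> 1 / 2"
  proof -
    have "(\<lambda>N. a * real N powr (- 1 / 2)) \<longlonglongrightarrow> a * 0"
      by (intro tendsto_mult tendsto_const tendsto_neg_powr filterlim_real_sequentially) simp
    then have "t \<longlonglongrightarrow> 0" by (simp add: t_def)
    then have "\<forall>\<^sub>F N in sequentially. dist (t N) 0 < 1 / 2" by (rule tendstoD) simp
    then show ?thesis by eventually_elim simp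
  qed
  have \<kappa>_small: "\<forall>\<^sub>F N in sequentially. 2 * \<kappa> (\<rho> N) < \<bar>a\<bar>" if "\<alpha>1 < 0"
  proof -
    have "(\<lambda>N. real N powr \<alpha>1) \<longlonglongrightarrow> 0"
      by (rule tendsto_neg_powr[OF that filterlim_real_sequentially])
    then have "(\<lambda>N. d1 * (real N powr \<alpha>1 / (1 + real N powr \<alpha>1))) \<longlonglongrightarrow> d1 * (0 / (1 + 0))"
      by (intro tendsto_intros) auto
    then have "r \<longlonglongrightarrow> 0" by (simp add: r_def)
    then have "(\<lambda>N. 2 * (34 * (r N / (1 - r N)))) \<longlonglongrightarrow> 2 * (34 * (0 / (1 - 0)))"
      by (intro tendsto_intros) auto
    then have "(\<lambda>N. 2 * \<kappa> (\<rho> N)) \<longlonglongrightarrow> 0" using that by (simp add: \<kappa>_def \<rho>_def)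
    then show ?thesis by (rule order_tendstoD) (use a in simp)
  qed
  then have \<kappa>_small: "\<forall>\<^sub>F N in sequentially. \<alpha>1 < 0 \<longrightarrow> 2 * \<kappa> (\<rho> N) < \<bar>a\<bar>"
    by (cases "\<alpha>1 < 0") auto
  have N_large: "\<forall>\<^sub>F N in sequentially. 4 * s\<^sup>2 \<le> real N"
    using filterlim_real_sequentially by (auto simp: filterlim_at_top)
  have moments1: "\<forall>\<^sub>F N in sequentially. \<forall>k\<ge>1. cmod (LINT \<omega>|P N. Z N 0 \<omega> ^ k) \<le> 1 / real N"
  proof (rule eventually_moment_le[where P = P and Z = Z])
    show "prob_space (P N)" if "N \<ge> 1" for N by (rule prob[OF that])
    show "cmod (Z N 0 \<omega>) = 1" if "N \<ge> 1" "\<omega> \<in> space (P N)" for N \<omega>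
      by (rule Z_circle) (use that in auto)
  qed (rule moments)
  have bad: "\<forall>\<^sub>F N in sequentially. \<exists>B\<in>sets (P N). exp (- (4 * s\<^sup>2)) / 4 \<le> measure (P N) B \<and> B \<inter> ?\<Omega> N = {}"
    using moments1 N_large \<kappa>_small t_small eventually_ge_at_top[of 1]
  proof eventually_elim
    case (elim N)
    then have N: "N \<ge> 1" by simp
    interpret prob_space "P N" by (rule prob[OF N])
    interpret haar_diagonal_model "P N" N "V N" "Z N"
    proof unfold_locales
      show "indep_var (borel_unitary N) (V N) (borel_mat N) (\<lambda>\<omega>. mat_diag N (\<lambda>i. Z N i \<omega>))"
        using VD_indep[OF N] by (simp add: D[abs_def])
      show "cmod (LINT \<omega>|P N. Z N 0 \<omega> ^ k) \<le> 1 / real N" if "k \<ge> 1" for k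
        using elim(1) that by blast
    qed (rule N V_meas[OF N] V_haar[OF N] Z_circle[OF N] Z_indep[OF N] Z_ident[OF N]; assumption)+
    have M_eq: "M N = conj_diag" by (simp add: fun_eq_iff M D conj_diag_def)
    let ?B = "{\<omega> \<in> space (P N). total_deviation N (\<rho> N) s (conj_diag \<omega>) (v N \<omega>) \<le> \<kappa> (\<rho> N)}"
    have "(\<exists>u. \<forall>\<omega>\<in>space (P N). v N \<omega> = u) \<or> indep_rv (P N) (borel_vec N) (v N) (borel_mat N) conj_diag"
      using v_cases[OF N] M_eq by auto
    from prob_small_total_deviation_random_vector[OF s0 elim(2) \<rho>[OF N] v_unit[OF N] this]
    have B: "?B \<in> events" "exp (- (4 * s\<^sup>2)) / 4 \<le> prob ?B"
      unfolding \<kappa>_def by blast+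
    have "eig_count (G N (t N) \<omega>) (ball 0 (r N)) \<noteq> 1" if \<omega>: "\<omega> \<in> ?B" for \<omega>
    proof -
      have sp: "\<omega> \<in> space (P N)" and T: "total_deviation N (\<rho> N) s (conj_diag \<omega>) (v N \<omega>) \<le> \<kappa> (\<rho> N)"
        using \<omega> by auto
      have G_eq: "G N (t N) \<omega> = V N \<omega> * mat_diag N (\<lambda>i. Z N i \<omega>) * mat_adjoint (V N \<omega>) *
          (1\<^sub>m N - of_real (1 - t N) \<cdot>\<^sub>m proj_mat (v N \<omega>))"
        unfolding G A M D by simp
      have tN: "\<bar>1 - t N\<bar> = 1 - t N" "1 / 2 \<le> 1 - t N" "1 - t N \<le> 3 / 2" using elim(4) by linarith+
      note eig = V_unitary[OF sp] v_unit[OF N sp]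
      have circle: "cmod (Z N i \<omega>) = 1" if "i < N" for i by (rule Z_circle[OF that sp])
      show ?thesis
      proof (cases "\<alpha>1 \<ge> 0")
        case True
        have \<rho>N: "\<rho> N = d1 / 2" using True by (simp add: \<rho>_def)
        have "s / 2 * (\<rho> N)\<^sup>2 = 2 * \<bar>a\<bar> + \<kappa> (\<rho> N) + 1"
          using True d1 by (simp add: s_def \<rho>N)
        then have "(1 - t N) * s / 2 * (\<rho> N)\<^sup>2 = (1 - t N) * (2 * \<bar>a\<bar> + \<kappa> (\<rho> N) + 1)"
          by (metis mult.assoc times_divide_eq_right)
        also have "\<dots> = (1 - t N) * (2 * \<bar>a\<bar>) + (1 - t N) * \<kappa> (\<rho> N) + (1 - t N)"
          by (simp add: algebra_simps)
        finally have s_eq: "(1 - t N) * s / 2 * (\<rho> N)\<^sup>2 = \<dots>" .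
        have "1 / 2 * (2 * \<bar>a\<bar>) \<le> (1 - t N) * (2 * \<bar>a\<bar>)"
          by (rule mult_right_mono) (use tN in auto)
        moreover have "(1 - t N) * total_deviation N (\<rho> N) s (conj_diag \<omega>) (v N \<omega>) \<le> (1 - t N) * \<kappa> (\<rho> N)"
          by (rule mult_left_mono[OF T]) (use tN in simp)
        ultimately have large: "\<bar>t N\<bar> * sqrt (real N) + (1 - t N) * total_deviation N (\<rho> N) s (conj_diag \<omega>) (v N \<omega>)
            < (1 - t N) * s / 2 * (\<rho> N)\<^sup>2"
          unfolding s_eq sqrt_t[OF N] using tN(2) by linarith
        have "eig_count (G N (t N) \<omega>) (ball 0 (\<rho> N)) = 2"
          unfolding G_eq
          by (rule eig_count_eq_2[where s = s, OF eig _ \<rho>[OF N] _ N])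
             (use circle tN large[unfolded conj_diag_def] in auto)
        moreover have "eig_count (G N (t N) \<omega>) (ball 0 (\<rho> N)) \<le> eig_count (G N (t N) \<omega>) (ball 0 (r N))"
        proof (rule eig_count_mono)
          have "real N powr \<alpha>1 \<ge> 1" using N True by (simp add: ge_one_powr_ge_zero)
          then have "1 / 2 \<le> real N powr \<alpha>1 / (1 + real N powr \<alpha>1)" by (simp add: field_simps)
          then have "d1 * (1 / 2) \<le> r N" unfolding r_def using d1 by (intro mult_left_mono) auto
          then show "ball 0 (\<rho> N) \<subseteq> ball (0::complex) (r N)" unfolding \<rho>N by (intro subset_ball) simp
          have "conj_diag \<omega> \<in> carrier_mat N N" using measurable_space[OF conj_diag_measurable sp] by simp
          moreover have "1\<^sub>m N - complex_of_real (1 - t N) \<cdot>\<^sub>m proj_mat (v N \<omega>) \<in> carrier_mat N N"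
            using eig(2) by (auto simp: proj_mat_def unit_vectors_def)
          ultimately show "G N (t N) \<omega> \<in> carrier_mat N N"
            unfolding G_eq conj_diag_def[symmetric] by (rule mult_carrier_mat)
        qed
        ultimately show ?thesis by simp
      next
        case False
        have \<rho>N: "\<rho> N = r N" and s: "s = 0" using False by (simp_all add: \<rho>_def s_def)
        have "0 \<le> \<kappa> (\<rho> N)" using \<rho>[OF N] by (simp add: \<kappa>_def)
        have "\<bar>1 - t N\<bar> * total_deviation N (\<rho> N) 0 (conj_diag \<omega>) (v N \<omega>) \<le> \<bar>1 - t N\<bar> * \<kappa> (\<rho> N)"
          using T s by (intro mult_left_mono) auto
        also have "\<dots> \<le> 2 * \<kappa> (\<rho> N)"
          using tN \<open>0 \<le> \<kappa> (\<rho> N)\<close> by (intro mult_right_mono) auto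
        also have "\<dots> < \<bar>t N\<bar> * sqrt (real N)" using elim(3) False sqrt_t[OF N] by simp
        finally have small: "\<bar>1 - t N\<bar> * total_deviation N (\<rho> N) 0 (conj_diag \<omega>) (v N \<omega>) < \<bar>t N\<bar> * sqrt (real N)" .
        have "eig_count (G N (t N) \<omega>) (ball 0 (r N)) = 0"
          unfolding G_eq \<rho>N[symmetric]
          by (rule eig_count_eq_0[OF eig _ \<rho>[OF N]])
             (use circle small[unfolded conj_diag_def] in auto)
        then show ?thesis by simp
      qed
    qed
    then have "?B \<inter> ?\<Omega> N = {}" unfolding t_def r_def by blast
    with B show ?case by blast
  qed
  have "\<not> with_high_probability P ?\<Omega>"
  proof (rule not_with_high_probability[OF _ _ bad])
    show "prob_space (P N)" if "N \<ge> 1" for N by (rule prob[OF that])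
  qed simp
  with whp show False by blast
qed

end
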